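(* Let $k\in\mathbb{N}$ and let $t_1,\ldots,t_n$ be group terms in $k$ variables. The following are equivalent: (1) $\mathcal{LG} \models e \le t_1 \lor \ldots \lor t_n$; (2) $\{t_1,\ldots,t_n\}$ does not extend to a right order of the free group $\mathbf{F}(k)$; (3) there exist $s_1,\ldots,s_m \in F(k)\setminus\{e\}$ such that $e \in \langle \{t_1,\ldots,t_n,s_1^{\delta_1},\ldots,s_m^{\delta_m}\}\rangle$ for all $\delta_1,\ldots,\delta_m \in \{-1,1\}$.
   Context: An $\ell$-group is an algebra $\langle L,\land,\lor,\cdot,{}^{-1},e\rangle$ such that $\langle L,\cdot,{}^{-1},e\rangle$ is a group, $\langle L,\land,\lor\rangle$ is a lattice, and $a\le b$ implies $cad\le cbd$. $\mathcal{LG}$ is the variety of all $\ell$-groups; $\mathcal{LG}\models e\le t_1\lor\dots\lor t_n$ means the inequation holds in every $\ell$-group under every assignment. $\mathbf{F}(k)$ is the free group on $k$ generators, and group terms are identified with their images in it. For $S\subseteq F(k)$, $\langle S\rangle$ is the subsemigroup generated by $S$. A partial right order of a group $\mathbf{G}$ is a partial order $\le$ on $G$ with $a\le b \Rightarrow ac\le bc$; it is a right order if every element $a$ satisfies $e<a$, $a<e$ or $a=e$. A subset $S$ extends to a right order if there is a right order $\le$ with $e<s$ for all $s\in S$. *)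

theory Defs
  imports
    "HOL-Algebra.Group"
    "HOL-Library.Infinite_Typeclass"
    "HOL-Library.Countable_Set"
begin

section \<open>Group terms\<close>

datatype gterm = GVar nat | GOne | GMult gterm gterm | GInv gterm

primrec gvars :: "gterm \<Rightarrow> nat set" where
  "gvars (GVar i) = {i}"
| "gvars GOne = {}"
| "gvars (GMult s t) = gvars s \<union> gvars t"
| "gvars (GInv t) = gvars t"

primrec geval :: "('a, 'm) monoid_scheme \<Rightarrow> (nat \<Rightarrow> 'a) \<Rightarrow> gterm \<Rightarrow> 'a" where
  "geval G \<phi> (GVar i) = \<phi> i"
| "geval G \<phi> GOne = \<one>\<^bsub>G\<^esub>"
| "geval G \<phi> (GMult s t) = geval G \<phi> s \<otimes>\<^bsub>G\<^esub> geval G \<phi> t"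
| "geval G \<phi> (GInv t) = inv\<^bsub>G\<^esub> (geval G \<phi> t)"


section \<open>Lattice-ordered groups\<close>

record 'a lgroup = "'a monoid" +
  lmeet :: "'a \<Rightarrow> 'a \<Rightarrow> 'a"
  ljoin :: "'a \<Rightarrow> 'a \<Rightarrow> 'a"

definition lg_le :: "('a, 'm) lgroup_scheme \<Rightarrow> 'a \<Rightarrow> 'a \<Rightarrow> bool" where
  "lg_le L a b \<longleftrightarrow> lmeet L a b = a"

locale l_group = group L for L :: "('a, 'm) lgroup_scheme" (structure) +
  assumes lmeet_closed: "\<lbrakk>a \<in> carrier L; b \<in> carrier L\<rbrakk> \<Longrightarrow> lmeet L a b \<in> carrier L"
    and ljoin_closed: "\<lbrakk>a \<in> carrier L; b \<in> carrier L\<rbrakk> \<Longrightarrow> ljoin L a b \<in> carrier L"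
    and lmeet_comm: "\<lbrakk>a \<in> carrier L; b \<in> carrier L\<rbrakk> \<Longrightarrow> lmeet L a b = lmeet L b a"
    and ljoin_comm: "\<lbrakk>a \<in> carrier L; b \<in> carrier L\<rbrakk> \<Longrightarrow> ljoin L a b = ljoin L b a"
    and lmeet_assoc: "\<lbrakk>a \<in> carrier L; b \<in> carrier L; c \<in> carrier L\<rbrakk>
          \<Longrightarrow> lmeet L (lmeet L a b) c = lmeet L a (lmeet L b c)"
    and ljoin_assoc: "\<lbrakk>a \<in> carrier L; b \<in> carrier L; c \<in> carrier L\<rbrakk>
          \<Longrightarrow> ljoin L (ljoin L a b) c = ljoin L a (ljoin L b c)"
    and lmeet_absorb: "\<lbrakk>a \<in> carrier L; b \<in> carrier L\<rbrakk> \<Longrightarrow> lmeet L a (ljoin L a b) = a"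
    and ljoin_absorb: "\<lbrakk>a \<in> carrier L; b \<in> carrier L\<rbrakk> \<Longrightarrow> ljoin L a (lmeet L a b) = a"
    and lg_le_mult: "\<lbrakk>a \<in> carrier L; b \<in> carrier L; c \<in> carrier L; d \<in> carrier L; lg_le L a b\<rbrakk>
          \<Longrightarrow> lg_le L (c \<otimes> a \<otimes> d) (c \<otimes> b \<otimes> d)"

text \<open>The join of a nonempty list; the empty join is left unspecified.\<close>

fun lg_Join :: "('a, 'm) lgroup_scheme \<Rightarrow> 'a list \<Rightarrow> 'a" where
  "lg_Join L [] = undefined"
| "lg_Join L [x] = x"
| "lg_Join L (x # y # ys) = ljoin L x (lg_Join L (y # ys))"

text \<open>
  Validity of \<open>e \<le> t\<^sub>1 \<or> \<dots> \<or> t\<^sub>n\<close> in every \<open>\<ell>\<close>-group.  HOL cannot quantify over types inside a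
  formula, so the type \<open>'a\<close> from which the carriers (arbitrary subsets of \<open>'a\<close>) are drawn is a
  parameter.  By \<open>LG_models_any_type\<close> below, the choice is immaterial as long as \<open>'a\<close> is infinite:
  validity over one infinite type implies validity over every type.
\<close>

definition LG_models :: "'a itself \<Rightarrow> nat \<Rightarrow> gterm list \<Rightarrow> bool" where
  "LG_models (_ :: 'a itself) k ts \<longleftrightarrow>
     (\<forall>L :: 'a lgroup. l_group L \<longrightarrow>
        (\<forall>\<phi> \<in> {..<k} \<rightarrow> carrier L. lg_le L \<one>\<^bsub>L\<^esub> (lg_Join L (map (geval L \<phi>) ts))))"


section \<open>The free group on \<open>k\<close> generators\<close>

text \<open>
  Elements are reduced words; the letter \<open>(i, True)\<close> stands for the \<open>i\<close>-th generator and
  \<open>(i, False)\<close> for its inverse.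
\<close>

type_synonym letter = "nat \<times> bool"

definition inv_letter :: "letter \<Rightarrow> letter" where
  "inv_letter a = (fst a, \<not> snd a)"

definition reduced :: "letter list \<Rightarrow> bool" where
  "reduced w \<longleftrightarrow> successively (\<lambda>a b. b \<noteq> inv_letter a) w"

fun push :: "letter \<Rightarrow> letter list \<Rightarrow> letter list" where
  "push a [] = [a]"
| "push a (b # w) = (if b = inv_letter a then w else a # b # w)"

definition free_group :: "nat \<Rightarrow> letter list monoid" where
  "free_group k =
     \<lparr>carrier = {w. reduced w \<and> fst ` set w \<subseteq> {..<k}}, mult = foldr push, one = []\<rparr>"

definition free_gen :: "nat \<Rightarrow> letter list" where
  "free_gen i = [(i, True)]"

definition free_image :: "nat \<Rightarrow> gterm \<Rightarrow> letter list" where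
  "free_image k t = geval (free_group k) free_gen t"


section \<open>Right orders and generated subsemigroups\<close>

definition partial_right_order :: "('a, 'm) monoid_scheme \<Rightarrow> 'a rel \<Rightarrow> bool" where
  "partial_right_order G r \<longleftrightarrow> partial_order_on (carrier G) r \<and>
     (\<forall>a\<in>carrier G. \<forall>b\<in>carrier G. \<forall>c\<in>carrier G.
        (a, b) \<in> r \<longrightarrow> (a \<otimes>\<^bsub>G\<^esub> c, b \<otimes>\<^bsub>G\<^esub> c) \<in> r)"

definition strict :: "'a rel \<Rightarrow> 'a \<Rightarrow> 'a \<Rightarrow> bool" where
  "strict r a b \<longleftrightarrow> (a, b) \<in> r \<and> a \<noteq> b"

definition right_order :: "('a, 'm) monoid_scheme \<Rightarrow> 'a rel \<Rightarrow> bool" where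
  "right_order G r \<longleftrightarrow> partial_right_order G r \<and>
     (\<forall>a\<in>carrier G. strict r \<one>\<^bsub>G\<^esub> a \<or> strict r a \<one>\<^bsub>G\<^esub> \<or> a = \<one>\<^bsub>G\<^esub>)"

definition extends_to_right_order :: "('a, 'm) monoid_scheme \<Rightarrow> 'a set \<Rightarrow> bool" where
  "extends_to_right_order G S \<longleftrightarrow> (\<exists>r. right_order G r \<and> (\<forall>s\<in>S. strict r \<one>\<^bsub>G\<^esub> s))"

inductive_set subsemigroup :: "('a, 'm) monoid_scheme \<Rightarrow> 'a set \<Rightarrow> 'a set"
  for G :: "('a, 'm) monoid_scheme" and S :: "'a set" where
  incl: "s \<in> S \<Longrightarrow> s \<in> subsemigroup G S"
| mult: "\<lbrakk>a \<in> subsemigroup G S; b \<in> subsemigroup G S\<rbrakk> \<Longrightarrow> a \<otimes>\<^bsub>G\<^esub> b \<in> subsemigroup G S"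


section \<open>The reduced-word construction is the free group\<close>

lemma inv_letter_inv_letter [simp]: "inv_letter (inv_letter a) = a"
  by (simp add: inv_letter_def)

lemma inv_letter_neq [simp]: "inv_letter a \<noteq> a" "a \<noteq> inv_letter a"
  by (cases a; simp add: inv_letter_def)+

lemma reduced_Nil [simp]: "reduced []"
  by (simp add: reduced_def)

lemma reduced_Cons: "reduced (a # w) \<longleftrightarrow> w = [] \<or> hd w \<noteq> inv_letter a \<and> reduced w"
  by (auto simp: reduced_def successively_Cons)

lemma reduced_push: "reduced w \<Longrightarrow> reduced (push a w)"
  by (cases w) (auto simp: reduced_Cons)

lemma push_inv_push: "reduced w \<Longrightarrow> push (inv_letter a) (push a w) = w"
  by (cases w rule: remdups_adj.cases) (auto simp: reduced_Cons)

lemma push_push_inv: "reduced w \<Longrightarrow> push a (push (inv_letter a) w) = w"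
  using push_inv_push[of w "inv_letter a"] by simp

lemma reduced_foldr_push: "reduced w \<Longrightarrow> reduced (foldr push v w)"
  by (induction v) (auto intro: reduced_push)

lemma foldr_push_push:
  assumes "reduced w"
  shows "foldr push (push a v) w = push a (foldr push v w)"
proof (cases v)
  case (Cons b u)
  then show ?thesis
    using push_push_inv[of "foldr push u w" a] reduced_foldr_push[OF assms] by auto
qed simp

lemma foldr_push_assoc:
  "reduced w \<Longrightarrow> foldr push (foldr push u v) w = foldr push u (foldr push v w)"
  by (induction u) (auto simp: foldr_push_push)

lemma foldr_push_Nil: "reduced w \<Longrightarrow> foldr push w [] = w"
proof (induction w)
  case (Cons a w)
  then show ?case by (cases w) (auto simp: reduced_Cons)
qed simp

lemma foldr_push_inverse:
  "reduced w \<Longrightarrow> foldr push (rev (map inv_letter v)) (foldr push v w) = w"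
  by (induction v) (auto simp: push_inv_push reduced_foldr_push)

lemma set_push: "set (push a w) \<subseteq> insert a (set w)"
  by (cases w) auto

lemma set_foldr_push: "set (foldr push v w) \<subseteq> set v \<union> set w"
proof (induction v)
  case (Cons a v)
  then show ?case using set_push[of a "foldr push v w"] by auto
qed simp

lemma group_free_group: "group (free_group k)"
proof (rule groupI)
  fix x y assume "x \<in> carrier (free_group k)" "y \<in> carrier (free_group k)"
  then show "x \<otimes>\<^bsub>free_group k\<^esub> y \<in> carrier (free_group k)"
    using set_foldr_push[of x y] by (fastforce simp: free_group_def reduced_foldr_push)
next
  fix x assume x: "x \<in> carrier (free_group k)"
  define y where "y = foldr push (rev (map inv_letter x)) []"
  have "set y \<subseteq> inv_letter ` set x"
    using set_foldr_push[of "rev (map inv_letter x)" "[]"] by (auto simp: y_def)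
  then have "fst ` set y \<subseteq> fst ` set x"
    by (force simp: inv_letter_def)
  then have "y \<in> carrier (free_group k)"
    using x by (auto simp: free_group_def y_def reduced_foldr_push)
  moreover have "foldr push y x = []"
  proof -
    have "foldr push y x = foldr push (rev (map inv_letter x)) (foldr push x [])"
      using x foldr_push_assoc[of x "rev (map inv_letter x)" "[]"]
      by (auto simp: free_group_def y_def foldr_push_Nil)
    then show ?thesis by (simp add: foldr_push_inverse)
  qed
  ultimately show "\<exists>y\<in>carrier (free_group k). y \<otimes>\<^bsub>free_group k\<^esub> x = \<one>\<^bsub>free_group k\<^esub>"
    by (auto simp: free_group_def)
qed (auto simp: free_group_def foldr_push_assoc)

lemma free_gen_closed: "i < k \<Longrightarrow> free_gen i \<in> carrier (free_group k)"
  by (simp add: free_gen_def free_group_def reduced_Cons)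

definition letter_val :: "('a, 'm) monoid_scheme \<Rightarrow> (nat \<Rightarrow> 'a) \<Rightarrow> letter \<Rightarrow> 'a" where
  "letter_val G \<phi> a = (if snd a then \<phi> (fst a) else inv\<^bsub>G\<^esub> \<phi> (fst a))"

definition word_val :: "('a, 'm) monoid_scheme \<Rightarrow> (nat \<Rightarrow> 'a) \<Rightarrow> letter list \<Rightarrow> 'a" where
  "word_val G \<phi> w = foldr (\<lambda>a x. letter_val G \<phi> a \<otimes>\<^bsub>G\<^esub> x) w \<one>\<^bsub>G\<^esub>"

theorem free_group_universal:
  assumes G: "group G" and \<phi>: "\<phi> \<in> {..<k} \<rightarrow> carrier G"
  shows "\<exists>h \<in> hom (free_group k) G. (\<forall>i<k. h (free_gen i) = \<phi> i) \<and>
    (\<forall>h' \<in> hom (free_group k) G. (\<forall>i<k. h' (free_gen i) = \<phi> i) \<longrightarrow>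
       (\<forall>w \<in> carrier (free_group k). h' w = h w))"
proof -
  interpret G: group G by fact
  interpret F: group "free_group k" by (rule group_free_group)
  let ?h = "word_val G \<phi>"
  have Cons: "?h (a # w) = letter_val G \<phi> a \<otimes>\<^bsub>G\<^esub> ?h w" for a w
    by (simp add: word_val_def)
  have lv: "letter_val G \<phi> a \<in> carrier G" if "fst a < k" for a
    using that \<phi> by (auto simp: letter_val_def)
  have lvi: "letter_val G \<phi> (inv_letter a) = inv\<^bsub>G\<^esub> letter_val G \<phi> a" if "fst a < k" for a
    using that G.inv_inv[OF Pi_mem[OF \<phi>], of "fst a"]
    by (auto simp: letter_val_def inv_letter_def)
  have cl: "?h w \<in> carrier G" if "fst ` set w \<subseteq> {..<k}" for w
    using that by (induction w) (auto simp: word_val_def lv)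
  have pu: "?h (push a w) = letter_val G \<phi> a \<otimes>\<^bsub>G\<^esub> ?h w"
    if "fst a < k" "fst ` set w \<subseteq> {..<k}" for a w
  proof (cases w)
    case (Cons b u)
    then show ?thesis using that lv[of a] cl[of u]
      by (auto simp: \<open>\<And>a w. ?h (a # w) = _\<close> lvi G.m_assoc[symmetric])
  qed (simp add: Cons)
  have fo: "?h (foldr push v w) = ?h v \<otimes>\<^bsub>G\<^esub> ?h w"
    if "fst ` set v \<subseteq> {..<k}" "fst ` set w \<subseteq> {..<k}" for v w
    using that
  proof (induction v)
    case Nil
    then show ?case using cl[of w] by (simp add: word_val_def)
  next
    case (Cons a v)
    then have "fst ` set (foldr push v w) \<subseteq> {..<k}"
      using set_foldr_push[of v w] by fastforce
    then show ?case
      using Cons pu[of a "foldr push v w"] cl[of v] cl[of w] lv[of a]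
      by (simp add: \<open>\<And>a w. ?h (a # w) = _\<close> G.m_assoc)
  qed
  have hom: "?h \<in> hom (free_group k) G"
    by (auto simp: hom_def free_group_def intro!: cl fo)
  have gen: "?h (free_gen i) = \<phi> i" if "i < k" for i
    using that Pi_mem[OF \<phi>, of i] by (auto simp: word_val_def letter_val_def free_gen_def)
  have uniq: "h' w = ?h w"
    if h': "h' \<in> hom (free_group k) G" and g: "\<forall>i<k. h' (free_gen i) = \<phi> i"
      and w: "w \<in> carrier (free_group k)" for h' w
    using w
  proof (induction w)
    case Nil
    have "h' \<one>\<^bsub>free_group k\<^esub> = \<one>\<^bsub>G\<^esub>"
      using h' by (rule hom_one) (rule group_free_group, rule G)
    then show ?case by (simp add: free_group_def word_val_def)
  next
    case (Cons a w)
    obtain i b where a: "a = (i, b)" by (cases a)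
    have i: "i < k" and w: "w \<in> carrier (free_group k)"
      and aw: "a # w = push a w" and ac: "[a] \<in> carrier (free_group k)"
      using Cons.prems a by (cases w; auto simp: free_group_def reduced_Cons)+
    have "[a] \<otimes>\<^bsub>free_group k\<^esub> w = a # w"
      using aw by (simp add: free_group_def)
    then have eq: "h' (a # w) = h' [a] \<otimes>\<^bsub>G\<^esub> h' w"
      using hom_mult[OF h' ac w] by simp
    have "h' [a] = letter_val G \<phi> a"
    proof (cases b)
      case True
      then show ?thesis using g i a by (simp add: letter_val_def free_gen_def)
    next
      case False
      interpret gh: group_hom "free_group k" G h'
        by (simp add: group_hom_def group_hom_axioms_def h' G group_free_group)
      have "[a] \<otimes>\<^bsub>free_group k\<^esub> free_gen i = \<one>\<^bsub>free_group k\<^esub>"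
        using False a by (simp add: free_group_def free_gen_def inv_letter_def)
      then have "[a] = inv\<^bsub>free_group k\<^esub> free_gen i"
        using F.inv_equality ac free_gen_closed[OF i] by metis
      then show ?thesis
        using False a g i free_gen_closed[OF i] by (simp add: letter_val_def)
    qed
    then show ?case using eq Cons.IH[OF w] by (simp add: \<open>\<And>a w. ?h (a # w) = _\<close>)
  qed
  show ?thesis using hom gen uniq by blast
qed


section \<open>Independence of the carrier type\<close>

text \<open>
  The subalgebra generated by the values of \<open>k\<close> variables is the set of values of \<open>\<ell>\<close>-group terms,
  hence countable, and can be copied into any infinite type.
\<close>

datatype lterm = LVar nat | LOne | LMult lterm lterm | LInv lterm
  | LMeet lterm lterm | LJoin lterm lterm

instance lterm :: countable
  by countable_datatype

primrec leval :: "('a, 'm) lgroup_scheme \<Rightarrow> (nat \<Rightarrow> 'a) \<Rightarrow> lterm \<Rightarrow> 'a" where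
  "leval L \<phi> (LVar i) = \<phi> i"
| "leval L \<phi> LOne = \<one>\<^bsub>L\<^esub>"
| "leval L \<phi> (LMult s t) = leval L \<phi> s \<otimes>\<^bsub>L\<^esub> leval L \<phi> t"
| "leval L \<phi> (LInv t) = inv\<^bsub>L\<^esub> (leval L \<phi> t)"
| "leval L \<phi> (LMeet s t) = lmeet L (leval L \<phi> s) (leval L \<phi> t)"
| "leval L \<phi> (LJoin s t) = ljoin L (leval L \<phi> s) (leval L \<phi> t)"

theorem LG_models_any_type:
  assumes valid: "LG_models TYPE('a::infinite) k ts"
    and ne: "ts \<noteq> []" and vars: "\<forall>t \<in> set ts. gvars t \<subseteq> {..<k}"
  shows "LG_models TYPE('b) k ts"
  unfolding LG_models_def
proof (intro allI impI ballI)
  fix L :: "'b lgroup" and \<phi>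
  assume L: "l_group L" and \<phi>: "\<phi> \<in> {..<k} \<rightarrow> carrier L"
  interpret L: l_group L by fact
  define \<psi> where "\<psi> i = (if i < k then \<phi> i else \<one>\<^bsub>L\<^esub>)" for i
  define H where "H = range (leval L \<psi>)"
  have \<psi>H: "\<psi> i \<in> H" for i
    unfolding H_def by (rule range_eqI[of _ _ "LVar i"]) simp
  have oneH: "\<one>\<^bsub>L\<^esub> \<in> H"
    unfolding H_def by (rule range_eqI[of _ _ LOne]) simp
  have multH: "x \<otimes>\<^bsub>L\<^esub> y \<in> H" if "x \<in> H" "y \<in> H" for x y
    using that unfolding H_def by (auto intro: range_eqI[of _ _ "LMult _ _"])
  have invH: "inv\<^bsub>L\<^esub> x \<in> H" if "x \<in> H" for x
    using that unfolding H_def by (auto intro: range_eqI[of _ _ "LInv _"])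
  have meetH: "lmeet L x y \<in> H" if "x \<in> H" "y \<in> H" for x y
    using that unfolding H_def by (auto intro: range_eqI[of _ _ "LMeet _ _"])
  have joinH: "ljoin L x y \<in> H" if "x \<in> H" "y \<in> H" for x y
    using that unfolding H_def by (auto intro: range_eqI[of _ _ "LJoin _ _"])
  have "leval L \<psi> t \<in> carrier L" for t
    by (induction t) (use \<phi> in \<open>auto simp: \<psi>_def L.lmeet_closed L.ljoin_closed\<close>)
  then have HL: "x \<in> carrier L" if "x \<in> H" for x
    using that by (auto simp: H_def)
  have "countable H" by (simp add: H_def)
  moreover obtain f0 :: "nat \<Rightarrow> 'a" where "inj f0"
    using infinite_countable_subset[OF infinite_UNIV] by blast
  ultimately obtain f :: "'b \<Rightarrow> 'a" where f: "inj_on f H"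
    by (metis comp_inj_on inj_on_subset inj_on_to_nat_on subset_UNIV)
  define g where "g = inv_into H f"
  have gf [simp]: "g (f x) = x" if "x \<in> H" for x
    using that f by (simp add: g_def)
  define M :: "'a lgroup" where "M =
    \<lparr>carrier = f ` H, mult = (\<lambda>x y. f (g x \<otimes>\<^bsub>L\<^esub> g y)), one = f \<one>\<^bsub>L\<^esub>,
     lmeet = (\<lambda>x y. f (lmeet L (g x) (g y))), ljoin = (\<lambda>x y. f (ljoin L (g x) (g y)))\<rparr>"
  have Mc: "carrier M = f ` H" and Mo: "\<one>\<^bsub>M\<^esub> = f \<one>\<^bsub>L\<^esub>"
    and Mm: "x \<in> H \<Longrightarrow> y \<in> H \<Longrightarrow> f x \<otimes>\<^bsub>M\<^esub> f y = f (x \<otimes>\<^bsub>L\<^esub> y)"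
    and Mme: "x \<in> H \<Longrightarrow> y \<in> H \<Longrightarrow> lmeet M (f x) (f y) = f (lmeet L x y)"
    and Mj: "x \<in> H \<Longrightarrow> y \<in> H \<Longrightarrow> ljoin M (f x) (f y) = f (ljoin L x y)" for x y
    by (simp_all add: M_def)
  have feq: "f x = f y \<longleftrightarrow> x = y" if "x \<in> H" "y \<in> H" for x y
    using that f by (auto dest: inj_onD)
  have Mle: "lg_le M (f x) (f y) \<longleftrightarrow> lg_le L x y" if "x \<in> H" "y \<in> H" for x y
    using that by (simp add: lg_le_def Mme feq meetH)
  have gM: "group M"
  proof (rule groupI)
    fix x assume "x \<in> carrier M"
    then obtain u where u: "u \<in> H" "x = f u" by (auto simp: Mc)
    then have "f (inv\<^bsub>L\<^esub> u) \<otimes>\<^bsub>M\<^esub> x = \<one>\<^bsub>M\<^esub>"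
      using HL by (simp add: Mm invH Mo)
    then show "\<exists>y\<in>carrier M. y \<otimes>\<^bsub>M\<^esub> x = \<one>\<^bsub>M\<^esub>" using u invH Mc by blast
  qed (auto simp: Mc Mo Mm multH oneH HL L.m_assoc)
  interpret M: group M by fact
  have lgM: "l_group M"
  proof (intro l_group.intro gM l_group_axioms.intro)
    fix a b assume "a \<in> carrier M" "b \<in> carrier M"
    then obtain x y where [simp]: "x \<in> H" "y \<in> H" "a = f x" "b = f y" by (auto simp: Mc)
    note [simp] = Mc Mme Mj meetH joinH HL feq
    show "lmeet M a b \<in> carrier M" "ljoin M a b \<in> carrier M" by auto
    show "lmeet M a b = lmeet M b a" "ljoin M a b = ljoin M b a"
      by (simp_all add: L.lmeet_comm L.ljoin_comm)
    show "lmeet M a (ljoin M a b) = a" "ljoin M a (lmeet M a b) = a"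
      by (simp_all add: L.lmeet_absorb L.ljoin_absorb)
  next
    fix a b c assume "a \<in> carrier M" "b \<in> carrier M" "c \<in> carrier M"
    then obtain x y z where "x \<in> H" "y \<in> H" "z \<in> H" "a = f x" "b = f y" "c = f z"
      by (auto simp: Mc)
    then show "lmeet M (lmeet M a b) c = lmeet M a (lmeet M b c)"
      "ljoin M (ljoin M a b) c = ljoin M a (ljoin M b c)"
      by (simp_all add: Mme Mj meetH joinH HL L.lmeet_assoc L.ljoin_assoc)
  next
    fix a b c d
    assume "a \<in> carrier M" "b \<in> carrier M" "c \<in> carrier M" "d \<in> carrier M" and le: "lg_le M a b"
    then obtain x y z w where "x \<in> H" "y \<in> H" "z \<in> H" "w \<in> H"
        "a = f x" "b = f y" "c = f z" "d = f w"
      by (auto simp: Mc)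
    then show "lg_le M (c \<otimes>\<^bsub>M\<^esub> a \<otimes>\<^bsub>M\<^esub> d) (c \<otimes>\<^bsub>M\<^esub> b \<otimes>\<^bsub>M\<^esub> d)"
      using le L.lg_le_mult[of x y z w] by (simp add: Mm Mle multH HL)
  qed
  have Mi: "inv\<^bsub>M\<^esub> (f x) = f (inv\<^bsub>L\<^esub> x)" if "x \<in> H" for x
    by (rule M.inv_equality) (use that in \<open>auto simp: Mc Mm Mo invH HL\<close>)
  have ev: "geval L \<psi> t \<in> H \<and> geval M (f \<circ> \<psi>) t = f (geval L \<psi> t)" for t
    by (induction t) (auto simp: \<psi>H oneH multH invH Mo Mm Mi)
  have jo: "lg_Join L (map (geval L \<psi>) us) \<in> H \<and>
      lg_Join M (map (geval M (f \<circ> \<psi>)) us) = f (lg_Join L (map (geval L \<psi>) us))"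
    if "us \<noteq> []" for us
    using that by (induction us rule: induct_list012) (auto simp: ev joinH Mj)
  have "f \<circ> \<psi> \<in> {..<k} \<rightarrow> carrier M" using \<psi>H by (auto simp: Mc)
  then have "lg_le M \<one>\<^bsub>M\<^esub> (lg_Join M (map (geval M (f \<circ> \<psi>)) ts))"
    using valid lgM by (auto simp: LG_models_def)
  then have "lg_le L \<one>\<^bsub>L\<^esub> (lg_Join L (map (geval L \<psi>) ts))"
    using jo[OF ne] by (simp add: Mo Mle oneH)
  moreover have "geval L \<psi> t = geval L \<phi> t" if "gvars t \<subseteq> {..<k}" for t
    using that by (induction t) (auto simp: \<psi>_def)
  ultimately show "lg_le L \<one>\<^bsub>L\<^esub> (lg_Join L (map (geval L \<phi>) ts))"
    using vars by (metis (no_types, lifting) map_eq_conv)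
qed

end

theory Submission
  imports Defs
begin

text \<open>
  A right order amounts to a positive cone.  If (3) fails, then, running through the countable free
  group, one can choose signs for all elements one after the other while keeping every finite set
  of further choices possible; the chosen elements generate a positive cone.

  A right order of the free group with all \<open>t\<^sub>i\<close> positive refutes the inequation in the \<open>\<ell>\<close>-group of
  automorphisms of the free group under the reversed order: at the identity, every right translation
  by \<open>t\<^sub>i\<close> goes strictly down.

  Conversely, suppose \<open>e \<le> w\<close> fails in an \<open>\<ell>\<close>-group, where \<open>w\<close> is the value of the join.  Since the
  positive and negative parts of any \<open>a\<close> are disjoint, one of \<open>a\<close>, \<open>a\<^sup>-\<^sup>1\<close> can always be added to a
  set of elements whose products are never below \<open>w\<close>.  Pulled back to the free group this yields
  a submonoid \<open>M\<close> that contains \<open>x\<close> or \<open>x\<^sup>-\<^sup>1\<close> for every \<open>x\<close> and omits all \<open>t\<^sub>i\<close>.  The complement of \<open>M\<close>,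
  refined on \<open>M \<inter> M\<^sup>-\<^sup>1\<close> by some right order of the free group, is the desired cone.
\<close>

section \<open>Positive cones\<close>

text \<open>The strict positive cone of a right order. \<open>P\<close> is disjoint from its set of
  inverses, since \<open>x\<close> and \<open>inv x\<close> both in \<open>P\<close> would put the
  identity into \<open>P\<close>.\<close>

definition positive_cone :: "('a, 'm) monoid_scheme \<Rightarrow> 'a set \<Rightarrow> bool" where
  "positive_cone G P \<longleftrightarrow> P \<subseteq> carrier G \<and> \<one>\<^bsub>G\<^esub> \<notin> P \<and>
     (\<forall>x\<in>P. \<forall>y\<in>P. x \<otimes>\<^bsub>G\<^esub> y \<in> P) \<and>
     (\<forall>x\<in>carrier G. x \<noteq> \<one>\<^bsub>G\<^esub> \<longrightarrow> x \<in> P \<or> inv\<^bsub>G\<^esub> x \<in> P)"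

lemma partial_right_orderD:
  assumes "partial_right_order G r"
  shows "(a, b) \<in> r \<Longrightarrow> a \<in> carrier G \<and> b \<in> carrier G"
    and "a \<in> carrier G \<Longrightarrow> (a, a) \<in> r"
    and "(a, b) \<in> r \<Longrightarrow> (b, c) \<in> r \<Longrightarrow> (a, c) \<in> r"
    and "(a, b) \<in> r \<Longrightarrow> (b, a) \<in> r \<Longrightarrow> a = b"
    and "(a, b) \<in> r \<Longrightarrow> c \<in> carrier G \<Longrightarrow> (a \<otimes>\<^bsub>G\<^esub> c, b \<otimes>\<^bsub>G\<^esub> c) \<in> r"
proof -
  have r: "r \<subseteq> carrier G \<times> carrier G" "refl_on (carrier G) r" "trans r" "antisym r"
    and c: "\<forall>a\<in>carrier G. \<forall>b\<in>carrier G. \<forall>c\<in>carrier G.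
      (a, b) \<in> r \<longrightarrow> (a \<otimes>\<^bsub>G\<^esub> c, b \<otimes>\<^bsub>G\<^esub> c) \<in> r"
    using assms by (auto simp: partial_right_order_def order_on_defs)
  show *: "(a, b) \<in> r \<Longrightarrow> a \<in> carrier G \<and> b \<in> carrier G" using r(1) by auto
  show "a \<in> carrier G \<Longrightarrow> (a, a) \<in> r" using r(2) by (simp add: refl_on_def)
  show "(a, b) \<in> r \<Longrightarrow> (b, c) \<in> r \<Longrightarrow> (a, c) \<in> r" using r(3) by (rule transD)
  show "(a, b) \<in> r \<Longrightarrow> (b, a) \<in> r \<Longrightarrow> a = b" using r(4) by (rule antisymD)
  show "(a, b) \<in> r \<Longrightarrow> c \<in> carrier G \<Longrightarrow> (a \<otimes>\<^bsub>G\<^esub> c, b \<otimes>\<^bsub>G\<^esub> c) \<in> r" using c * by simp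
qed

lemma (in group) positive_cone_extends_to_right_order:
  assumes P: "positive_cone G P" and "S \<subseteq> P"
  shows "extends_to_right_order G S"
proof -
  have Pc: "x \<in> carrier G" if "x \<in> P" for x
    using that P by (auto simp: positive_cone_def)
  have P1: "\<one> \<notin> P" and Pm: "\<And>x y. x \<in> P \<Longrightarrow> y \<in> P \<Longrightarrow> x \<otimes> y \<in> P"
    and Pt: "\<And>x. x \<in> carrier G \<Longrightarrow> x \<noteq> \<one> \<Longrightarrow> x \<in> P \<or> inv x \<in> P"
    using P by (auto simp: positive_cone_def)
  \<comment> \<open>The inverse stands on the right so that a common right factor cancels: (b c)(a
    c)^-1 = b a^-1.\<close>
  define r where "r = {(a, b). a \<in> carrier G \<and> b \<in> carrier G \<and> (a = b \<or> b \<otimes> inv a \<in> P)}"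
  have diff: "c \<otimes> inv a = (c \<otimes> inv b) \<otimes> (b \<otimes> inv a)"
    if "a \<in> carrier G" "b \<in> carrier G" "c \<in> carrier G" for a b c
  proof -
    have "inv b \<otimes> (b \<otimes> inv a) = inv a" using that by (simp add: inv_solve_left')
    then show ?thesis using that by (simp add: m_assoc)
  qed
  have "trans r"
  proof (rule transI)
    fix a b c assume "(a, b) \<in> r" "(b, c) \<in> r"
    then show "(a, c) \<in> r"
      using Pm[of "c \<otimes> inv b" "b \<otimes> inv a"] diff[of a b c] by (auto simp: r_def)
  qed
  moreover have "antisym r"
  proof (rule antisymI)
    fix a b assume "(a, b) \<in> r" "(b, a) \<in> r"
    then show "a = b"
      using Pm[of "a \<otimes> inv b" "b \<otimes> inv a"] diff[of a b a] P1 by (auto simp: r_def)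
  qed
  moreover have "r \<subseteq> carrier G \<times> carrier G" "refl_on (carrier G) r"
    by (auto simp: r_def refl_on_def)
  moreover have "(a \<otimes> c, b \<otimes> c) \<in> r" if "(a, b) \<in> r" "c \<in> carrier G" for a b c
  proof -
    have ab: "a \<in> carrier G" "b \<in> carrier G" using that by (auto simp: r_def)
    have "(b \<otimes> c) \<otimes> inv (a \<otimes> c) = b \<otimes> inv a"
      using ab that(2) by (simp add: inv_mult_group m_assoc) (simp add: m_assoc[symmetric])
    then show ?thesis using that ab by (auto simp: r_def)
  qed
  ultimately have "partial_right_order G r"
    by (auto simp: partial_right_order_def order_on_defs)
  moreover have "strict r \<one> a \<or> strict r a \<one> \<or> a = \<one>" if "a \<in> carrier G" for a
    using that Pt[OF that] by (auto simp: strict_def r_def)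
  ultimately have "right_order G r" by (auto simp: right_order_def)
  moreover have "strict r \<one> s" if "s \<in> S" for s
    using that \<open>S \<subseteq> P\<close> P1 Pc by (auto simp: strict_def r_def)
  ultimately show ?thesis by (auto simp: extends_to_right_order_def)
qed

text \<open>Translating one <= a by \<open>b\<close> gives b <= a b, so one < b <= a b.\<close>

lemma (in group) right_order_strict_mult:
  assumes r: "right_order G r" and "strict r \<one> a" "strict r \<one> b"
  shows "strict r \<one> (a \<otimes> b)"
proof -
  have pr: "partial_right_order G r" using r by (simp add: right_order_def)
  note D = partial_right_orderD[OF pr]
  have ab: "(\<one>, a) \<in> r" "(\<one>, b) \<in> r" "b \<noteq> \<one>" and b: "b \<in> carrier G"
    using assms D(1) by (auto simp: strict_def)
  have *: "(b, a \<otimes> b) \<in> r" using D(5)[OF ab(1) b] b by simp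
  then have "(\<one>, a \<otimes> b) \<in> r" using ab D(3) by blast
  moreover have "a \<otimes> b \<noteq> \<one>" using * ab D(4) by metis
  ultimately show ?thesis by (simp add: strict_def)
qed

text \<open>\<open>right_order\<close> compares elements only with the identity; comparing
  \<open>a \<otimes> inv b\<close> with it and translating by \<open>b\<close> compares
  \<open>a\<close> with \<open>b\<close>.\<close>

lemma (in group) right_order_total:
  assumes r: "right_order G r" and a: "a \<in> carrier G" and b: "b \<in> carrier G"
  shows "(a, b) \<in> r \<or> (b, a) \<in> r"
proof -
  have pr: "partial_right_order G r" using r by (simp add: right_order_def)
  note D = partial_right_orderD[OF pr]
  let ?c = "a \<otimes> inv b"
  have "strict r \<one> ?c \<or> strict r ?c \<one> \<or> ?c = \<one>"
    using r a b unfolding right_order_def by auto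
  then have "(\<one>, ?c) \<in> r \<or> (?c, \<one>) \<in> r"
    using D(2)[of \<one>] by (auto simp: strict_def)
  moreover have "?c \<otimes> b = a" using a b by (simp add: m_assoc)
  ultimately show ?thesis
    using D(5)[of \<one> ?c b] D(5)[of ?c \<one> b] b by auto
qed

section \<open>Choosing signs\<close>

text \<open>\<open>B\<close> holds the forbidden products. \<open>E\<close> may contain more than
  the signs of \<open>A\<close>, so that preimages under homomorphisms can serve as
  \<open>E\<close>. Two instances matter: \<open>B\<close> the identity alone, and \<open>B\<close>
  the words whose value is at most \<open>w\<close>.\<close>

definition signable :: "('a, 'm) monoid_scheme \<Rightarrow> 'a set \<Rightarrow> 'a set \<Rightarrow> 'a set \<Rightarrow> bool" where
  "signable G X B S \<longleftrightarrow> (\<forall>A. finite A \<and> A \<subseteq> X \<longrightarrow>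
     (\<exists>E \<subseteq> carrier G. (\<forall>a\<in>A. a \<in> E \<or> inv\<^bsub>G\<^esub> a \<in> E) \<and> subsemigroup G (S \<union> E) \<inter> B = {}))"

section \<open>Generated subsemigroups\<close>

lemma subsemigroup_mono: "S \<subseteq> T \<Longrightarrow> x \<in> subsemigroup G S \<Longrightarrow> x \<in> subsemigroup G T"
  by (erule subsemigroup.induct) (auto intro: subsemigroup.intros)

lemma (in group) subsemigroup_closed:
  "S \<subseteq> carrier G \<Longrightarrow> x \<in> subsemigroup G S \<Longrightarrow> x \<in> carrier G"
  by (erule subsemigroup.induct) auto

lemma subsemigroup_hom:
  assumes "h \<in> hom G H" "S \<subseteq> carrier G" "group G" "h ` S \<subseteq> T" "x \<in> subsemigroup G S"
  shows "h x \<in> subsemigroup H T"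
  using assms(5)
proof induction
  case (incl s)
  then show ?case using assms by (auto intro: subsemigroup.incl)
next
  case (mult a b)
  then show ?case
    using group.subsemigroup_closed[OF assms(3,2)] hom_mult[OF assms(1)]
    by (metis subsemigroup.mult)
qed

text \<open>A product uses finitely many generators, all of which are present from some stage
  on.\<close>

lemma subsemigroup_UN_chain:
  assumes "\<And>n. S n \<subseteq> S (Suc n)" and "x \<in> subsemigroup G (\<Union>n. S n)"
  shows "\<exists>n. x \<in> subsemigroup G (S (n::nat))"
  using assms(2)
proof induction
  case (incl s)
  then show ?case by (auto intro: subsemigroup.incl)
next
  case (mult a b)
  then obtain i j where ij: "a \<in> subsemigroup G (S i)" "b \<in> subsemigroup G (S j)" by blast
  have "S i \<subseteq> S (max i j)" "S j \<subseteq> S (max i j)"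
    using lift_Suc_mono_le[of S, OF assms(1)] by simp_all
  then have "a \<otimes>\<^bsub>G\<^esub> b \<in> subsemigroup G (S (max i j))"
    using ij by (intro subsemigroup.mult) (erule subsemigroup_mono[rotated], assumption)+
  then show ?case ..
qed

text \<open>If both choices failed, at finite sets \<open>A1\<close> and \<open>A2\<close>, a good
  \<open>E\<close> for \<open>A1\<close>, \<open>A2\<close> and \<open>a\<close> together would
  contain \<open>a\<close> or its inverse, so that adding this element to \<open>S\<close> changes
  nothing and one of the failures is refuted.\<close>

lemma signable_insert:
  assumes "signable G X B S" and "a \<in> X"
  shows "signable G X B (insert a S) \<or> signable G X B (insert (inv\<^bsub>G\<^esub> a) S)"
proof (rule ccontr)
  assume "\<not> ?thesis"
  then obtain A1 A2 where
    A1: "finite A1" "A1 \<subseteq> X" "\<And>E. E \<subseteq> carrier G \<Longrightarrow> \<forall>a\<in>A1. a \<in> E \<or> inv\<^bsub>G\<^esub> a \<in> E \<Longrightarrow>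
           subsemigroup G (insert a S \<union> E) \<inter> B \<noteq> {}" and
    A2: "finite A2" "A2 \<subseteq> X" "\<And>E. E \<subseteq> carrier G \<Longrightarrow> \<forall>a\<in>A2. a \<in> E \<or> inv\<^bsub>G\<^esub> a \<in> E \<Longrightarrow>
           subsemigroup G (insert (inv\<^bsub>G\<^esub> a) S \<union> E) \<inter> B \<noteq> {}"
    unfolding signable_def by metis
  have "finite (insert a (A1 \<union> A2)) \<and> insert a (A1 \<union> A2) \<subseteq> X"
    using A1 A2 assms(2) by auto
  then obtain E where E: "E \<subseteq> carrier G" "\<forall>b\<in>insert a (A1 \<union> A2). b \<in> E \<or> inv\<^bsub>G\<^esub> b \<in> E"
    "subsemigroup G (S \<union> E) \<inter> B = {}"
    using assms(1) unfolding signable_def by meson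
  then have "insert a S \<union> E = S \<union> E \<or> insert (inv\<^bsub>G\<^esub> a) S \<union> E = S \<union> E" by auto
  then show False using A1(3)[of E] A2(3)[of E] E by auto
qed

text \<open>Countability lets the signs be decided one element at a time. The union of the stages
  avoids \<open>B\<close> because each of its products already arises at some stage.\<close>

lemma signable_total_extension:
  fixes G :: "('a::countable, 'm) monoid_scheme" (structure)
  assumes G: "group G" and T: "signable G X B T" "T \<subseteq> carrier G" and X: "X \<subseteq> carrier G"
  obtains S where "T \<subseteq> S" "S \<subseteq> carrier G" "\<forall>a\<in>X. a \<in> S \<or> inv\<^bsub>G\<^esub> a \<in> S"
    "subsemigroup G S \<inter> B = {}"
proof -
  interpret group G by fact
  \<comment> \<open>Stage \<open>n\<close> decides the element coded by \<open>n\<close>; codes of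
    elements outside \<open>X\<close> change nothing.\<close>
  define grow where "grow n U = (let a = from_nat n in if a \<notin> X then U
      else if signable G X B (insert a U) then insert a U else insert (inv a) U)" for n U
  define S where "S = rec_nat T grow"
  have S0: "S 0 = T" and Suc: "S (Suc n) = grow n (S n)" for n
    by (simp_all add: S_def)
  note SS = Suc[unfolded grow_def]
  have inv: "signable G X B (S n) \<and> S n \<subseteq> carrier G" for n
  proof (induction n)
    case 0
    then show ?case using T S0 by simp
  next
    case (Suc n)
    then show ?case using signable_insert[of G X B "S n" "from_nat n"] X
      by (auto simp: SS Let_def)
  qed
  have chain: "S n \<subseteq> S (Suc n)" for n by (auto simp: SS Let_def)
  have "subsemigroup G (S n) \<inter> B = {}" for n
  proof -
    \<comment> \<open>Signability is applied to the empty set of further elements.\<close>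
    obtain E where "subsemigroup G (S n \<union> E) \<inter> B = {}"
      using inv[of n] unfolding signable_def by (meson empty_subsetI finite.emptyI)
    then show ?thesis using subsemigroup_mono[of "S n" "S n \<union> E"] by blast
  qed
  then have "subsemigroup G (\<Union>n. S n) \<inter> B = {}"
    using subsemigroup_UN_chain[of S, OF chain] by blast
  moreover have "\<forall>a\<in>X. a \<in> (\<Union>n. S n) \<or> inv a \<in> (\<Union>n. S n)"
  proof
    fix a assume "a \<in> X"
    then have "a \<in> S (Suc (to_nat a)) \<or> inv a \<in> S (Suc (to_nat a))"
      by (simp add: SS)
    then show "a \<in> (\<Union>n. S n) \<or> inv a \<in> (\<Union>n. S n)" by blast
  qed
  moreover have "T \<subseteq> (\<Union>n. S n)" using S0 by blast
  moreover have "(\<Union>n. S n) \<subseteq> carrier G" using inv by blast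
  ultimately show ?thesis by (intro that[of "\<Union>n. S n"]) assumption+
qed

text \<open>A right order dictates signs that make all generators, hence all products, positive.
  Conversely, absence of a family \<open>s\<close> means that every finite set of nonidentity
  elements has signs avoiding the identity, which is signability.\<close>

theorem extends_to_right_order_iff_signs:
  fixes G :: "('a::countable, 'm) monoid_scheme" (structure)
  assumes G: "group G" and T: "T \<subseteq> carrier G"
  shows "extends_to_right_order G T \<longleftrightarrow>
    \<not> (\<exists>(m::nat) s. (\<forall>i<m. s i \<in> carrier G - {\<one>\<^bsub>G\<^esub>}) \<and>
         (\<forall>\<delta> :: nat \<Rightarrow> int. (\<forall>i<m. \<delta> i \<in> {-1, 1}) \<longrightarrow>
            \<one>\<^bsub>G\<^esub> \<in> subsemigroup G (T \<union> {s i [^]\<^bsub>G\<^esub> \<delta> i | i. i < m})))"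
    (is "_ \<longleftrightarrow> \<not> ?signs")
proof
  interpret group G by fact
  assume "extends_to_right_order G T"
  then obtain r where r: "right_order G r" and rT: "\<forall>s\<in>T. strict r \<one>\<^bsub>G\<^esub> s"
    by (auto simp: extends_to_right_order_def)
  have pr: "partial_right_order G r" using r by (simp add: right_order_def)
  note D = partial_right_orderD[OF pr]
  show "\<not> ?signs"
  proof clarify
    fix m :: nat and s
    assume s: "\<forall>i<m. s i \<in> carrier G - {\<one>\<^bsub>G\<^esub>}" and
      e: "\<forall>\<delta> :: nat \<Rightarrow> int. (\<forall>i<m. \<delta> i \<in> {-1, 1}) \<longrightarrow>
            \<one>\<^bsub>G\<^esub> \<in> subsemigroup G (T \<union> {s i [^]\<^bsub>G\<^esub> \<delta> i | i. i < m})"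
    \<comment> \<open>The exponent that makes the power positive: as \<open>s i\<close> is not the
      identity, it is negative whenever it is not positive, and then its inverse is
      positive.\<close>
    define \<delta> :: "nat \<Rightarrow> int" where "\<delta> i = (if strict r \<one>\<^bsub>G\<^esub> (s i) then 1 else -1)" for i
    have \<delta>: "\<forall>i<m. \<delta> i \<in> {-1, 1}" by (simp add: \<delta>_def)
    have "strict r \<one> (s i [^]\<^bsub>G\<^esub> \<delta> i)" if "i < m" for i
    proof (cases "strict r \<one> (s i)")
      case True
      then show ?thesis using s that by (simp add: \<delta>_def)
    next
      case False
      then have "(s i, \<one>) \<in> r" using r s that by (auto simp: right_order_def strict_def)
      then have "(\<one>, inv (s i)) \<in> r" using D(5)[of "s i" \<one> "inv (s i)"] s that by simp
      moreover have "inv (s i) \<noteq> \<one>" using s that by simp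
      ultimately have "strict r \<one> (inv (s i))" by (metis strict_def)
      then show ?thesis using s that False by (simp add: \<delta>_def int_pow_neg)
    qed
    then have pos: "strict r \<one> x" if "x \<in> T \<union> {s i [^]\<^bsub>G\<^esub> \<delta> i | i. i < m}" for x
      using that rT by auto
    have "strict r \<one> x" if "x \<in> subsemigroup G (T \<union> {s i [^]\<^bsub>G\<^esub> \<delta> i | i. i < m})" for x
      using that by induction (fact pos, rule right_order_strict_mult[OF r])
    then show False using e \<delta> unfolding strict_def by blast
  qed
next
  interpret group G by fact
  assume ns: "\<not> ?signs"
  have "signable G (carrier G - {\<one>}) {\<one>} T"
    unfolding signable_def
  proof (intro allI impI)
    fix A assume A: "finite A \<and> A \<subseteq> carrier G - {\<one>}"
    then obtain xs where xs: "set xs = A" using finite_list by blast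
    have s: "\<forall>i<length xs. xs ! i \<in> carrier G - {\<one>}" using A xs nth_mem by blast
    \<comment> \<open>The enumeration \<open>xs\<close> of \<open>A\<close> is a candidate for the
      family in \<open>?signs\<close>; its failure supplies the signs.\<close>
    then obtain \<delta> :: "nat \<Rightarrow> int" where \<delta>: "\<forall>i<length xs. \<delta> i \<in> {-1, 1}"
      and e: "\<one> \<notin> subsemigroup G (T \<union> {xs ! i [^] \<delta> i | i. i < length xs})"
      using ns[unfolded not_ex, THEN spec, of "length xs", THEN spec, of "(!) xs"] by auto
    let ?E = "{xs ! i [^] \<delta> i | i. i < length xs}"
    have "a \<in> ?E \<or> inv a \<in> ?E" if a: "a \<in> A" for a
    proof -
      obtain i where i: "i < length xs" "xs ! i = a" using a xs by (metis in_set_conv_nth)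
      have "a [^] \<delta> i = a \<or> a [^] \<delta> i = inv a"
        using \<delta> i s by (auto simp: int_pow_neg)
      then show ?thesis using i by force
    qed
    moreover have "?E \<subseteq> carrier G" using s by auto
    ultimately show "\<exists>E\<subseteq>carrier G. (\<forall>a\<in>A. a \<in> E \<or> inv a \<in> E) \<and>
        subsemigroup G (T \<union> E) \<inter> {\<one>} = {}"
      using e by (intro exI[of _ ?E]) auto
  qed
  then obtain S where S: "T \<subseteq> S" "S \<subseteq> carrier G"
    "\<forall>a\<in>carrier G - {\<one>}. a \<in> S \<or> inv a \<in> S" "subsemigroup G S \<inter> {\<one>} = {}"
    using signable_total_extension[OF G _ T] by blast
  have "positive_cone G (subsemigroup G S)"
    unfolding positive_cone_def using S subsemigroup_closed[OF S(2)]
    by (auto intro: subsemigroup.intros)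
  then show "extends_to_right_order G T"
    using S(1) by (auto intro!: positive_cone_extends_to_right_order intro: subsemigroup.incl)
qed

text \<open>Read \<open>M\<close> as the elements at most the identity in a total right preorder.
  Its complement is strictly positive, and \<open>P\<close> decides on the subgroup of those
  \<open>x\<close> with both \<open>x\<close> and \<open>inv x\<close> in \<open>M\<close>.\<close>

lemma (in group) positive_cone_refine:
  assumes P: "positive_cone G P" and M: "M \<subseteq> carrier G"
    and mult: "\<And>x y. x \<in> M \<Longrightarrow> y \<in> M \<Longrightarrow> x \<otimes> y \<in> M"
    and total: "\<And>x. x \<in> carrier G \<Longrightarrow> x \<in> M \<or> inv x \<in> M"
  shows "positive_cone G {x \<in> carrier G. x \<notin> M \<or> inv x \<in> M \<and> x \<in> P}"
proof -
  let ?N = "{x \<in> carrier G. x \<notin> M \<or> inv x \<in> M \<and> x \<in> P}"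
  have "x \<otimes> y \<in> ?N" if "x \<in> ?N" "y \<in> ?N" for x y
  proof (cases "x \<otimes> y \<in> M")
    case True
    \<comment> \<open>Both disjuncts of \<open>?N\<close> put the inverses into \<open>M\<close>,
      the first by totality. Cancelling a factor of the product then shows that \<open>x\<close> and
      \<open>y\<close> lie in \<open>M\<close> too, so both come from \<open>P\<close>.\<close>
    have xy: "x \<in> carrier G" "y \<in> carrier G" "inv x \<in> M" "inv y \<in> M" using that total by auto
    then have "inv x \<otimes> (x \<otimes> y) = y" "(x \<otimes> y) \<otimes> inv y = x"
      by (simp_all add: m_assoc inv_solve_left')
    then have "x \<in> M" "y \<in> M" using mult True xy by metis+
    then have "x \<in> P" "y \<in> P" using that by auto
    then have "x \<otimes> y \<in> P" using P by (simp add: positive_cone_def)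
    moreover have "inv (x \<otimes> y) \<in> M" using xy mult by (simp add: inv_mult_group)
    ultimately show ?thesis using xy by simp
  qed (use that in auto)
  moreover have "\<one> \<in> M" using total[of \<one>] by simp
  moreover have "\<one> \<notin> P" using P by (simp add: positive_cone_def)
  moreover have "x \<in> ?N \<or> inv x \<in> ?N" if "x \<in> carrier G" "x \<noteq> \<one>" for x
    using that P total[of x] by (auto simp: positive_cone_def)
  ultimately show ?thesis unfolding positive_cone_def by blast
qed

section \<open>Inequalities in lattice-ordered groups\<close>

context l_group
begin

abbreviation le (infix "\<preceq>" 50) where "a \<preceq> b \<equiv> lg_le L a b"
abbreviation meet (infixl "\<triangle>" 70) where "a \<triangle> b \<equiv> lmeet L a b"
abbreviation join (infixl "\<nabla>" 65) where "a \<nabla> b \<equiv> ljoin L a b"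

lemmas [simp] = lmeet_closed ljoin_closed

section \<open>The order of an l-group and its compatibility with products\<close>

lemma le_refl [simp]: "a \<in> carrier L \<Longrightarrow> a \<preceq> a"
  unfolding lg_le_def by (metis ljoin_absorb lmeet_absorb lmeet_closed)

lemma le_antisym: "\<lbrakk>a \<in> carrier L; b \<in> carrier L; a \<preceq> b; b \<preceq> a\<rbrakk> \<Longrightarrow> a = b"
  unfolding lg_le_def by (metis lmeet_comm)

lemma le_trans:
  "\<lbrakk>a \<in> carrier L; b \<in> carrier L; c \<in> carrier L; a \<preceq> b; b \<preceq> c\<rbrakk> \<Longrightarrow> a \<preceq> c"
  unfolding lg_le_def by (metis lmeet_assoc)

lemma meet_lower1: "\<lbrakk>a \<in> carrier L; b \<in> carrier L\<rbrakk> \<Longrightarrow> a \<triangle> b \<preceq> a"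
  using le_refl[of a] unfolding lg_le_def by (metis lmeet_assoc lmeet_comm)

lemma meet_lower2: "\<lbrakk>a \<in> carrier L; b \<in> carrier L\<rbrakk> \<Longrightarrow> a \<triangle> b \<preceq> b"
  using meet_lower1[of b a] by (simp add: lmeet_comm)

lemma meet_greatest:
  "\<lbrakk>a \<in> carrier L; b \<in> carrier L; c \<in> carrier L; c \<preceq> a; c \<preceq> b\<rbrakk> \<Longrightarrow> c \<preceq> a \<triangle> b"
  unfolding lg_le_def by (metis lmeet_assoc)

lemma le_iff_join: "\<lbrakk>a \<in> carrier L; b \<in> carrier L\<rbrakk> \<Longrightarrow> a \<preceq> b \<longleftrightarrow> a \<nabla> b = b"
  unfolding lg_le_def by (metis ljoin_absorb ljoin_comm lmeet_absorb lmeet_comm)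

lemma join_upper1: "\<lbrakk>a \<in> carrier L; b \<in> carrier L\<rbrakk> \<Longrightarrow> a \<preceq> a \<nabla> b"
  by (simp add: lg_le_def lmeet_absorb)

lemma join_upper2: "\<lbrakk>a \<in> carrier L; b \<in> carrier L\<rbrakk> \<Longrightarrow> b \<preceq> a \<nabla> b"
  using join_upper1[of b a] by (simp add: ljoin_comm)

lemma join_least:
  "\<lbrakk>a \<in> carrier L; b \<in> carrier L; c \<in> carrier L; a \<preceq> c; b \<preceq> c\<rbrakk> \<Longrightarrow> a \<nabla> b \<preceq> c"
  by (simp add: le_iff_join ljoin_assoc)

lemma mult_left_mono:
  "\<lbrakk>a \<in> carrier L; b \<in> carrier L; c \<in> carrier L; a \<preceq> b\<rbrakk> \<Longrightarrow> c \<otimes> a \<preceq> c \<otimes> b"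
  using lg_le_mult[of a b c \<one>] by simp

lemma mult_right_mono:
  "\<lbrakk>a \<in> carrier L; b \<in> carrier L; c \<in> carrier L; a \<preceq> b\<rbrakk> \<Longrightarrow> a \<otimes> c \<preceq> b \<otimes> c"
  using lg_le_mult[of a b \<one> c] by simp

lemma mult_mono:
  "\<lbrakk>a \<in> carrier L; b \<in> carrier L; c \<in> carrier L; d \<in> carrier L; a \<preceq> b; c \<preceq> d\<rbrakk>
    \<Longrightarrow> a \<otimes> c \<preceq> b \<otimes> d"
  using le_trans[of "a \<otimes> c" "b \<otimes> c" "b \<otimes> d"] mult_left_mono mult_right_mono by simp

lemma le_mult_iff_left:
  assumes "a \<in> carrier L" "b \<in> carrier L" "c \<in> carrier L"
  shows "a \<preceq> c \<otimes> b \<longleftrightarrow> inv c \<otimes> a \<preceq> b"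
proof
  assume "a \<preceq> c \<otimes> b"
  then have "inv c \<otimes> a \<preceq> inv c \<otimes> (c \<otimes> b)" using assms by (intro mult_left_mono) auto
  then show "inv c \<otimes> a \<preceq> b" using assms by (simp add: m_assoc[symmetric])
next
  assume "inv c \<otimes> a \<preceq> b"
  then have "c \<otimes> (inv c \<otimes> a) \<preceq> c \<otimes> b" using assms by (intro mult_left_mono) auto
  then show "a \<preceq> c \<otimes> b" using assms by (simp add: m_assoc[symmetric])
qed

lemma le_mult_iff_right:
  assumes "a \<in> carrier L" "b \<in> carrier L" "c \<in> carrier L"
  shows "a \<preceq> b \<otimes> c \<longleftrightarrow> a \<otimes> inv c \<preceq> b"
proof
  assume "a \<preceq> b \<otimes> c"
  then have "a \<otimes> inv c \<preceq> (b \<otimes> c) \<otimes> inv c" using assms by (intro mult_right_mono) auto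
  then show "a \<otimes> inv c \<preceq> b" using assms by (simp add: m_assoc)
next
  assume "a \<otimes> inv c \<preceq> b"
  then have "(a \<otimes> inv c) \<otimes> c \<preceq> b \<otimes> c" using assms by (intro mult_right_mono) auto
  then show "a \<preceq> b \<otimes> c" using assms by (simp add: m_assoc)
qed

lemma inv_antimono:
  assumes "a \<in> carrier L" "b \<in> carrier L" "a \<preceq> b"
  shows "inv b \<preceq> inv a"
proof -
  have "inv a \<otimes> a \<preceq> inv a \<otimes> b" using assms by (intro mult_left_mono) auto
  then show ?thesis using assms le_mult_iff_right[of \<one> "inv a" b] by simp
qed

section \<open>Products, powers and meets of elements above the identity\<close>

lemma one_le_mult:
  "\<lbrakk>a \<in> carrier L; b \<in> carrier L; \<one> \<preceq> a; \<one> \<preceq> b\<rbrakk> \<Longrightarrow> \<one> \<preceq> a \<otimes> b"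
  using mult_mono[of \<one> a \<one> b] by simp

lemma pow_mono:
  "\<lbrakk>a \<in> carrier L; b \<in> carrier L; a \<preceq> b\<rbrakk> \<Longrightarrow> a [^] (n::nat) \<preceq> b [^] n"
  by (induction n) (auto intro: mult_mono)

lemma one_le_pow: "\<lbrakk>a \<in> carrier L; \<one> \<preceq> a\<rbrakk> \<Longrightarrow> \<one> \<preceq> a [^] (n::nat)"
  using pow_mono[of \<one> a n] by simp

text \<open>It suffices that \<open>?t\<close> is at most u x and u z, where u is \<open>?u\<close>.
  The first holds as one <= u and t <= x; the second because t z^-1 is below \<open>x\<close>, by
  z^-1 <= one, and below \<open>y\<close>.\<close>

lemma meet_mult_le:
  assumes c: "x \<in> carrier L" "y \<in> carrier L" "z \<in> carrier L"
    and ge: "\<one> \<preceq> x" "\<one> \<preceq> y" "\<one> \<preceq> z"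
  shows "x \<triangle> (y \<otimes> z) \<preceq> (x \<triangle> y) \<otimes> (x \<triangle> z)"
proof -
  let ?t = "x \<triangle> (y \<otimes> z)" and ?u = "x \<triangle> y"
  have t: "?t \<in> carrier L" "?t \<preceq> x" "?t \<preceq> y \<otimes> z"
    using c by (auto intro: meet_lower1 meet_lower2)
  have u: "?u \<in> carrier L" "\<one> \<preceq> ?u" using c ge by (auto intro: meet_greatest)
  have "?t \<preceq> ?u \<otimes> x" using mult_mono[of \<one> ?u ?t x] t u c by simp
  moreover have "?t \<preceq> ?u \<otimes> z"
  proof -
    have "inv z \<preceq> \<one>" using inv_antimono[of \<one> z] c ge by simp
    then have "?t \<otimes> inv z \<preceq> x" using mult_mono[of ?t x "inv z" \<one>] t c by simp
    moreover have "?t \<otimes> inv z \<preceq> y" using t c by (simp add: le_mult_iff_right[symmetric])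
    ultimately show ?thesis using t c by (simp add: le_mult_iff_right meet_greatest)
  qed
  ultimately have "inv ?u \<otimes> ?t \<preceq> x \<triangle> z"
    using t u c by (intro meet_greatest) (simp_all add: le_mult_iff_left[symmetric])
  then show ?thesis using t u c by (simp add: le_mult_iff_left)
qed

lemma meet_pow_le:
  assumes "x \<in> carrier L" "y \<in> carrier L" "\<one> \<preceq> x" "\<one> \<preceq> y"
  shows "x \<triangle> y [^] (n::nat) \<preceq> (x \<triangle> y) [^] n"
proof (induction n)
  case 0
  then show ?case using assms by (simp add: meet_lower2)
next
  case (Suc n)
  have "x \<triangle> y [^] Suc n \<preceq> (x \<triangle> y [^] n) \<otimes> (x \<triangle> y)"
    using assms by (simp add: meet_mult_le one_le_pow)
  moreover have "(x \<triangle> y [^] n) \<otimes> (x \<triangle> y) \<preceq> (x \<triangle> y) [^] Suc n"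
    using assms Suc by (simp add: mult_right_mono)
  ultimately show ?case
    using assms le_trans[of "x \<triangle> y [^] Suc n" "(x \<triangle> y [^] n) \<otimes> (x \<triangle> y)" "(x \<triangle> y) [^] Suc n"]
    by simp
qed

text \<open>From one <= q and a^-1 <= q follows p <= q a. So the meet \<open>?c\<close> satisfies c
  a^-1 <= q as well as c <= q, which gives c q <= q and then c <= one.\<close>

lemma positive_negative_parts_disjoint:
  assumes a: "a \<in> carrier L"
  shows "(a \<nabla> \<one>) \<triangle> (inv a \<nabla> \<one>) = \<one>"
proof -
  let ?p = "a \<nabla> \<one>" and ?q = "inv a \<nabla> \<one>"
  let ?c = "?p \<triangle> ?q"
  have c: "?c \<in> carrier L" "?c \<preceq> ?p" "?c \<preceq> ?q"
    using a by (auto intro: meet_lower1 meet_lower2)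
  have q: "inv a \<preceq> ?q" "\<one> \<preceq> ?q" and p: "\<one> \<preceq> ?p"
    using a by (auto intro: join_upper1 join_upper2)
  have "?p \<preceq> ?q \<otimes> a"
    using mult_right_mono[of \<one> ?q a] mult_right_mono[of "inv a" ?q a] q a
    by (intro join_least) auto
  then have "?c \<preceq> ?q \<otimes> a" using c a by (intro le_trans[of ?c ?p "?q \<otimes> a"]) auto
  then have "?c \<otimes> inv a \<preceq> ?q" using c a by (simp add: le_mult_iff_right)
  then have "inv a \<preceq> inv ?c \<otimes> ?q" using c a by (simp add: le_mult_iff_left)
  moreover have "\<one> \<preceq> inv ?c \<otimes> ?q" using c a by (simp add: le_mult_iff_left)
  ultimately have "?q \<preceq> inv ?c \<otimes> ?q" using c a by (intro join_least) auto
  then have "?c \<otimes> ?q \<preceq> ?q" using c a by (simp add: le_mult_iff_left)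
  then have "?c \<preceq> ?q \<otimes> inv ?q" using c a le_mult_iff_right[of ?c ?q "inv ?q"] by simp
  then have "?c \<preceq> \<one>" using a by simp
  moreover have "\<one> \<preceq> ?c" using p q a by (intro meet_greatest) auto
  ultimately show ?thesis using c by (intro le_antisym) auto
qed

text \<open>Meets with a positive \<open>x\<close> pass into products and powers, so in x <= (g z)^j
  both factors may be replaced by bounds of their meets with \<open>x\<close>; this is
  \<open>key\<close>. First, \<open>v \<triangle> p\<close> is disjoint from \<open>q\<close>, hence
  below g^m. Then, in v <= (g p)^n, the factor \<open>p\<close> shrinks to
  \<open>v \<triangle> p\<close> and so to g^m.\<close>

lemma bounded_by_pow:
  assumes c: "v \<in> carrier L" "g \<in> carrier L" "p \<in> carrier L" "q \<in> carrier L"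
    and ge: "\<one> \<preceq> v" "\<one> \<preceq> g" "\<one> \<preceq> p" "\<one> \<preceq> q" and pq: "p \<triangle> q = \<one>"
    and le: "v \<preceq> (g \<otimes> p) [^] (n::nat)" "v \<preceq> (g \<otimes> q) [^] (m::nat)"
  shows "v \<preceq> g [^] (Suc m * n)"
proof -
  have key: "x \<preceq> (y \<otimes> b) [^] j"
    if x: "x \<in> carrier L" "\<one> \<preceq> x" "x \<preceq> (g \<otimes> z) [^] (j::nat)" and z: "z \<in> carrier L" "\<one> \<preceq> z"
      and y: "y \<in> carrier L" "x \<triangle> g \<preceq> y" and b: "b \<in> carrier L" "x \<triangle> z \<preceq> b"
    for x y z b j
  proof -
    have "x \<triangle> (g \<otimes> z) \<preceq> (x \<triangle> g) \<otimes> (x \<triangle> z)"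
      using x z c ge by (intro meet_mult_le) auto
    moreover have "(x \<triangle> g) \<otimes> (x \<triangle> z) \<preceq> y \<otimes> b"
      using x y z c b by (intro mult_mono) auto
    ultimately have "x \<triangle> (g \<otimes> z) \<preceq> y \<otimes> b"
      using x y z b c le_trans[of "x \<triangle> (g \<otimes> z)" "(x \<triangle> g) \<otimes> (x \<triangle> z)" "y \<otimes> b"] by simp
    then have "(x \<triangle> (g \<otimes> z)) [^] j \<preceq> (y \<otimes> b) [^] j"
      using x y z b c by (intro pow_mono) auto
    moreover have "x \<triangle> (g \<otimes> z) [^] j \<preceq> (x \<triangle> (g \<otimes> z)) [^] j"
      using x z c ge by (intro meet_pow_le one_le_mult) auto
    moreover have "x \<triangle> (g \<otimes> z) [^] j = x" using x by (simp add: lg_le_def)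
    ultimately show ?thesis
      using x y z b c le_trans[of x "(x \<triangle> (g \<otimes> z)) [^] j" "(y \<otimes> b) [^] j"] by simp
  qed
  let ?x = "v \<triangle> p"
  have x: "?x \<in> carrier L" "\<one> \<preceq> ?x" "?x \<preceq> v" "?x \<preceq> p"
    using c ge by (auto intro: meet_greatest meet_lower1 meet_lower2)
  have "?x \<triangle> q \<preceq> p \<triangle> q"
    using c x meet_lower1[of ?x q] meet_lower2[of ?x q] le_trans[of "?x \<triangle> q" ?x p]
    by (intro meet_greatest) auto
  then have "?x \<triangle> q \<preceq> \<one>" by (simp add: pq)
  moreover have "?x \<preceq> (g \<otimes> q) [^] m"
    using x c le by (intro le_trans[of ?x v "(g \<otimes> q) [^] m"]) auto
  ultimately have "?x \<preceq> (g \<otimes> \<one>) [^] m"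
    using x c ge by (intro key[of ?x q m g \<one>]) (auto intro: meet_lower2)
  then have "v \<preceq> (g \<otimes> g [^] m) [^] n"
    using c ge le by (intro key[of v p n g "g [^] m"]) (auto intro: meet_lower2)
  moreover have "g \<otimes> g [^] m = g [^] Suc m" using c by (simp only: nat_pow_Suc2)
  ultimately show ?thesis using c by (simp only: nat_pow_pow)
qed

text \<open>The bound \<open>h\<close> dominates the inverses of all chosen elements, while none of
  its powers reaches \<open>v\<close>. By \<open>bounded_by_pow\<close> the latter survives
  multiplying the bound by the positive part of \<open>a\<close> or by that of
  \<open>inv a\<close>.\<close>

lemma bounded_sign_choice:
  assumes "finite A" "A \<subseteq> carrier L" and v: "v \<in> carrier L" "\<one> \<preceq> v"
    and "g \<in> carrier L" "\<one> \<preceq> g" "\<And>n::nat. \<not> v \<preceq> g [^] n"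
  shows "\<exists>E h. E \<subseteq> carrier L \<and> (\<forall>a\<in>A. a \<in> E \<or> inv a \<in> E) \<and> h \<in> carrier L \<and> g \<preceq> h \<and>
    (\<forall>x\<in>E. inv x \<preceq> h) \<and> (\<forall>n::nat. \<not> v \<preceq> h [^] n)"
  using assms(1,2,5-7)
proof (induction A arbitrary: g rule: finite_induct)
  case empty
  then show ?case by (intro exI[of _ "{}"] exI[of _ g]) auto
next
  case (insert a A)
  have a: "a \<in> carrier L" using insert.prems by simp
  let ?p = "a \<nabla> \<one>" and ?q = "inv a \<nabla> \<one>"
  have pq: "?p \<in> carrier L" "?q \<in> carrier L" "\<one> \<preceq> ?p" "\<one> \<preceq> ?q" "a \<preceq> ?p" "inv a \<preceq> ?q"
    using a by (auto intro: join_upper1 join_upper2)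
  \<comment> \<open>Choosing \<open>inv a\<close> costs the factor \<open>?p\<close>, which
    dominates its inverse \<open>a\<close>; choosing \<open>a\<close> costs the factor
    \<open>?q\<close>.\<close>
  have "\<exists>x y. x \<in> {a, inv a} \<and> y \<in> carrier L \<and> \<one> \<preceq> y \<and> inv x \<preceq> y \<and>
      (\<forall>n::nat. \<not> v \<preceq> (g \<otimes> y) [^] n)"
  proof (cases "\<forall>n::nat. \<not> v \<preceq> (g \<otimes> ?p) [^] n")
    case True
    then show ?thesis using pq a by (intro exI[of _ "inv a"] exI[of _ ?p]) simp
  next
    case False
    then have "\<not> v \<preceq> (g \<otimes> ?q) [^] m" for m :: nat
      using bounded_by_pow[OF v(1) _ pq(1,2) v(2) _ pq(3,4)
          positive_negative_parts_disjoint[OF a]] insert.prems by metis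
    then show ?thesis using pq by (intro exI[of _ a] exI[of _ ?q]) simp
  qed
  then obtain x y where x: "x \<in> {a, inv a}" and y: "y \<in> carrier L" "\<one> \<preceq> y" "inv x \<preceq> y"
    "\<And>n::nat. \<not> v \<preceq> (g \<otimes> y) [^] n" by auto
  have gy: "g \<otimes> y \<in> carrier L" "\<one> \<preceq> g \<otimes> y" "g \<preceq> g \<otimes> y" "y \<preceq> g \<otimes> y"
    using y insert.prems mult_mono[of g g \<one> y] mult_mono[of \<one> g y y] by (auto intro: one_le_mult)
  obtain E h where E: "E \<subseteq> carrier L" "\<forall>a\<in>A. a \<in> E \<or> inv a \<in> E" "h \<in> carrier L" "g \<otimes> y \<preceq> h"
    "\<forall>x\<in>E. inv x \<preceq> h" "\<forall>n::nat. \<not> v \<preceq> h [^] n"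
    using insert.IH[of "g \<otimes> y"] insert.prems gy y by auto
  have xc: "x \<in> carrier L" using x a by auto
  have "y \<preceq> h" "g \<preceq> h"
    using E y gy insert.prems le_trans[of y "g \<otimes> y" h] le_trans[of g "g \<otimes> y" h] by auto
  moreover have "inv x \<preceq> h" using calculation xc y E le_trans[of "inv x" y h] by auto
  ultimately show ?case
    using E x xc by (intro exI[of _ "insert x E"] exI[of _ h]) auto
qed

text \<open>Let \<open>?v\<close> be the positive part of \<open>inv w\<close>. It is not below the
  identity, so the starting bound one is admissible. A product x <= w would give inv w <= inv x <=
  h^n, hence v <= h^n, which is excluded.\<close>

lemma sign_choice:
  assumes A: "finite A" "A \<subseteq> carrier L" and w: "w \<in> carrier L" "\<not> \<one> \<preceq> w"
  shows "\<exists>E \<subseteq> carrier L. (\<forall>a\<in>A. a \<in> E \<or> inv a \<in> E) \<and> (\<forall>x\<in>subsemigroup L E. \<not> x \<preceq> w)"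
proof -
  let ?v = "inv w \<nabla> \<one>"
  have v: "?v \<in> carrier L" "\<one> \<preceq> ?v" "inv w \<preceq> ?v"
    using w by (auto intro: join_upper1 join_upper2)
  have "\<not> ?v \<preceq> \<one>"
  proof
    assume "?v \<preceq> \<one>"
    then have "inv w \<preceq> \<one>" using v w le_trans[of "inv w" ?v \<one>] by simp
    then show False using w inv_antimono[of "inv w" \<one>] by simp
  qed
  then obtain E h where E: "E \<subseteq> carrier L" "\<forall>a\<in>A. a \<in> E \<or> inv a \<in> E" "h \<in> carrier L" "\<one> \<preceq> h"
    "\<forall>x\<in>E. inv x \<preceq> h" "\<And>n::nat. \<not> ?v \<preceq> h [^] n"
    using bounded_sign_choice[OF A v(1,2), of \<one>] by auto
  have pow: "x \<in> carrier L \<and> (\<exists>n::nat. inv x \<preceq> h [^] n)" if "x \<in> subsemigroup L E" for x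
    using that
  proof induction
    case (incl s)
    then show ?case using E by (auto intro!: exI[of _ "1::nat"])
  next
    case (mult a b)
    then obtain i j :: nat where "inv a \<preceq> h [^] i" "inv b \<preceq> h [^] j" by auto
    then have "inv b \<otimes> inv a \<preceq> h [^] j \<otimes> h [^] i" using mult E by (intro mult_mono) auto
    then have "inv (a \<otimes> b) \<preceq> h [^] (j + i)" using mult E by (simp add: nat_pow_mult inv_mult_group)
    then show ?case using mult by auto
  qed
  have "\<not> x \<preceq> w" if xE: "x \<in> subsemigroup L E" for x
  proof
    assume "x \<preceq> w"
    obtain n :: nat where n: "inv x \<preceq> h [^] n" and x: "x \<in> carrier L" using pow[OF xE] by auto
    have "inv w \<preceq> inv x" using x w \<open>x \<preceq> w\<close> by (intro inv_antimono) auto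
    then have "inv w \<preceq> h [^] n" using n x w E le_trans[of "inv w" "inv x" "h [^] n"] by simp
    then have "?v \<preceq> h [^] n" using w E by (intro join_least) (auto intro: one_le_pow)
    then show False using E by blast
  qed
  then show ?thesis using E by blast
qed

lemma lg_Join_upper:
  "set xs \<subseteq> carrier L \<Longrightarrow> x \<in> set xs \<Longrightarrow> lg_Join L xs \<in> carrier L \<and> x \<preceq> lg_Join L xs"
proof (induction xs arbitrary: x rule: induct_list012)
  case (3 y z zs)
  have J: "lg_Join L (z # zs) \<in> carrier L" and y: "y \<in> carrier L" using 3 by auto
  have "x \<preceq> y \<nabla> lg_Join L (z # zs)"
  proof (cases "x = y")
    case False
    then have "x \<preceq> lg_Join L (z # zs)" and "x \<in> carrier L" using 3 by auto
    then show ?thesis using J y join_upper2 le_trans[of x "lg_Join L (z # zs)"] by simp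
  qed (use J y in \<open>simp add: join_upper1\<close>)
  then show ?case using J y by simp
qed auto

end

section \<open>A positive cone of the free group\<close>

text \<open>
  Order the letters linearly.  In the Cayley tree, a reduced word is a path from the identity;
  \<open>path_weight\<close> adds up the signs of its edges and, at every inner vertex, a sign telling whether
  the outgoing direction is above or below the direction back.  A word of length \<open>n > 0\<close> gets a sum
  of \<open>2 n - 1\<close> signs, hence an odd number.  The three paths between three vertices form a tripod
  along which everything cancels except the turns at the centre, where the linear order
  leaves at most \<open>1\<close>.  So \<open>path_weight\<close> is additive up to \<open>1\<close>, and the words of positive weight
  are closed under multiplication.
\<close>

definition letter_rank :: "letter \<Rightarrow> int" where
  "letter_rank a = 2 * int (fst a) + of_bool (snd a)"

definition turn :: "letter \<Rightarrow> letter \<Rightarrow> int" where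
  "turn a b = sgn (letter_rank b - letter_rank a)"

definition letter_sign :: "letter \<Rightarrow> int" where
  "letter_sign a = (if snd a then 1 else -1)"

fun path_weight :: "letter list \<Rightarrow> int" where
  "path_weight [] = 0"
| "path_weight [a] = letter_sign a"
| "path_weight (a # b # w) = letter_sign a + turn (inv_letter a) b + path_weight (b # w)"

abbreviation inv_word :: "letter list \<Rightarrow> letter list" where
  "inv_word w \<equiv> rev (map inv_letter w)"

lemma letter_rank_eq_iff: "letter_rank a = letter_rank b \<longleftrightarrow> a = b"
  by (cases a; cases b) (auto simp: letter_rank_def of_bool_def split: if_splits; presburger)

lemma letter_sign_inv: "letter_sign (inv_letter a) = - letter_sign a"
  by (simp add: letter_sign_def inv_letter_def)

lemma turn_swap: "turn b a = - turn a b"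
  by (simp add: turn_def sgn_if)

lemma odd_turn: "a \<noteq> b \<Longrightarrow> odd (turn a b)"
  using letter_rank_eq_iff[of a b] by (auto simp: turn_def sgn_if)

text \<open>If two letters coincide, the terms cancel. For distinct letters, transitivity of the
  linear order keeps \<open>turn a b\<close>, \<open>turn b c\<close> and \<open>turn c a\<close>
  from all having the same sign.\<close>

lemma turn_cocycle: "\<bar>turn a b + turn b c - turn a c\<bar> \<le> 1"
  by (auto simp: turn_def sgn_if)

lemma turn_bound: "\<bar>turn a b\<bar> \<le> 1"
  by (auto simp: turn_def sgn_if)

lemma path_weight_append:
  "v \<noteq> [] \<Longrightarrow> w \<noteq> [] \<Longrightarrow>
    path_weight (v @ w) = path_weight v + turn (inv_letter (last v)) (hd w) + path_weight w"
proof (induction v rule: path_weight.induct)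
  case (2 a)
  then show ?case by (cases w) auto
qed auto

text \<open>Walking backwards, every edge changes sign and every turn swaps its two
  directions.\<close>

lemma path_weight_inv_word: "path_weight (inv_word w) = - path_weight w"
proof (induction w rule: path_weight.induct)
  case (3 a b w)
  have "path_weight (inv_word (a # b # w)) = path_weight (inv_word (b # w))
      + turn (inv_letter (last (inv_word (b # w)))) (inv_letter a) + path_weight [inv_letter a]"
    by (simp add: path_weight_append del: append_assoc)
  then show ?case using 3 turn_swap[of b "inv_letter a"]
    by (simp add: letter_sign_inv)
qed (auto simp: letter_sign_inv)

lemma odd_path_weight: "reduced w \<Longrightarrow> w \<noteq> [] \<Longrightarrow> odd (path_weight w)"
proof (induction w rule: path_weight.induct)
  case (3 a b w)
  then show ?case using odd_turn[of "inv_letter a" b]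
    by (auto simp: reduced_Cons letter_sign_def)
qed (auto simp: letter_sign_def)

text \<open>\<open>c\<close> is the part of \<open>v\<close> that cancels against a prefix of
  \<open>w\<close>.\<close>

lemma foldr_push_cancellation:
  assumes "reduced v" "reduced w"
  shows "\<exists>x c y. v = x @ c \<and> w = inv_word c @ y \<and> foldr push v w = x @ y"
  using assms(1)
proof (induction v)
  case Nil
  then show ?case by (intro exI[of _ "[]"] exI[of _ w]) simp
next
  case (Cons a v)
  then obtain x c y where *: "v = x @ c" "w = inv_word c @ y" "foldr push v w = x @ y"
    by (auto simp: reduced_Cons)
  show ?case
  \<comment> \<open>The new letter can cancel only when \<open>x\<close> is empty; otherwise it
    meets the first letter of \<open>v\<close>, and \<open>a # v\<close> is reduced.\<close>
  proof (cases "x = [] \<and> y \<noteq> [] \<and> hd y = inv_letter a")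
    case True
    then have "w = inv_word (a # c) @ tl y" "foldr push (a # v) w = tl y"
      using * by (auto simp: neq_Nil_conv)
    then show ?thesis using * True by (intro exI[of _ "[]"] exI[of _ "a # c"] exI[of _ "tl y"]) simp
  next
    case False
    then have "push a (x @ y) = a # x @ y"
      using Cons.prems * by (cases x; cases y) (auto simp: reduced_Cons)
    then show ?thesis using * by (intro exI[of _ "a # x"] exI[of _ c] exI[of _ y]) simp
  qed
qed

text \<open>The weights of the legs \<open>x\<close>, \<open>c\<close> and \<open>y\<close> cancel.
  At the centre the directions are \<open>inv_letter (last x)\<close>, \<open>hd c\<close> and
  \<open>hd y\<close>, compared by \<open>turn_cocycle\<close>. If a leg is empty, at most one turn
  is left.\<close>

lemma path_weight_mult:
  assumes "reduced v" "reduced w"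
  shows "\<bar>path_weight v + path_weight w - path_weight (foldr push v w)\<bar> \<le> 1"
proof -
  obtain x c y where *: "v = x @ c" "w = inv_word c @ y" "foldr push v w = x @ y"
    using foldr_push_cancellation[OF assms] by blast
  have last_inv: "c \<noteq> [] \<Longrightarrow> inv_letter (last (inv_word c)) = hd c"
    by (cases c) auto
  show ?thesis
    using * turn_cocycle[of "inv_letter (last x)" "hd c" "hd y"]
      turn_bound[of "inv_letter (last x)" "hd y"] turn_bound[of "inv_letter (last x)" "hd c"]
      turn_bound[of "hd c" "hd y"] last_inv
    by (cases "x = []"; cases "c = []"; cases "y = []")
      (auto simp: path_weight_append path_weight_inv_word)
qed

lemma positive_cone_free_group:
  "positive_cone (free_group k) {w \<in> carrier (free_group k). path_weight w > 0}"
proof -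
  interpret F: group "free_group k" by (rule group_free_group)
  have red: "reduced w" if "w \<in> carrier (free_group k)" for w
    using that by (simp add: free_group_def)
  have mult: "v \<otimes>\<^bsub>free_group k\<^esub> w = foldr push v w" for v w by (simp add: free_group_def)
  have one: "\<one>\<^bsub>free_group k\<^esub> = []" by (simp add: free_group_def)
  have "path_weight (v \<otimes>\<^bsub>free_group k\<^esub> w) > 0"
    if vw: "v \<in> carrier (free_group k)" "w \<in> carrier (free_group k)"
      "path_weight v > 0" "path_weight w > 0" for v w
  proof -
    have "path_weight (foldr push v w) \<ge> 1"
      using path_weight_mult[OF red[OF vw(1)] red[OF vw(2)]] vw by linarith
    then show ?thesis by (simp add: mult)
  qed
  moreover have "path_weight w > 0 \<or> path_weight (inv\<^bsub>free_group k\<^esub> w) > 0"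
    if w: "w \<in> carrier (free_group k)" "w \<noteq> []" for w
  proof -
    let ?i = "inv\<^bsub>free_group k\<^esub> w"
    have i: "?i \<in> carrier (free_group k)" "?i \<noteq> []"
      using w F.inv_eq_1_iff one by auto
    have "foldr push w ?i = []" using w F.r_inv mult one by metis
    \<comment> \<open>The product is the empty word of weight 0. Two odd numbers have an even sum,
      so these two are opposite and nonzero.\<close>
    then have "\<bar>path_weight w + path_weight ?i\<bar> \<le> 1"
      using path_weight_mult[of w ?i] red w i by simp
    moreover have "odd (path_weight w)" "odd (path_weight ?i)"
      using odd_path_weight red w i by auto
    ultimately show ?thesis by presburger
  qed
  ultimately show ?thesis by (auto simp: positive_cone_def one)
qed

section \<open>The \<open>\<ell>\<close>-group of automorphisms of a chain\<close>

text \<open>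
  Products are composed from left to right, so that right translations of a group give a
  homomorphism.  Automorphisms are the identity off \<open>C\<close> to make them determined by their
  restriction to \<open>C\<close>.
\<close>

definition chain_aut :: "'a set \<Rightarrow> 'a rel \<Rightarrow> ('a \<Rightarrow> 'a) set" where
  "chain_aut C r = {f. f ` C = C \<and> (\<forall>x. x \<notin> C \<longrightarrow> f x = x) \<and>
     (\<forall>x\<in>C. \<forall>y\<in>C. (f x, f y) \<in> r \<longleftrightarrow> (x, y) \<in> r)}"

definition chain_lgroup :: "'a set \<Rightarrow> 'a rel \<Rightarrow> ('a \<Rightarrow> 'a) lgroup" where
  "chain_lgroup C r =
     \<lparr>carrier = chain_aut C r, mult = (\<lambda>f g. g \<circ> f), one = id,
      lmeet = (\<lambda>f g x. if (f x, g x) \<in> r then f x else g x),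
      ljoin = (\<lambda>f g x. if (f x, g x) \<in> r then g x else f x)\<rparr>"

locale chain =
  fixes C :: "'a set" and r :: "'a rel"
  assumes le_refl: "x \<in> C \<Longrightarrow> (x, x) \<in> r"
    and le_trans: "(x, y) \<in> r \<Longrightarrow> (y, z) \<in> r \<Longrightarrow> (x, z) \<in> r"
    and le_antisym: "(x, y) \<in> r \<Longrightarrow> (y, x) \<in> r \<Longrightarrow> x = y"
    and le_total: "x \<in> C \<Longrightarrow> y \<in> C \<Longrightarrow> (x, y) \<in> r \<or> (y, x) \<in> r"
begin

text \<open>Reversal turns meets into joins, and it supplies the order in which positive right
  translations move the identity down.\<close>

lemma chain_converse: "chain C (r\<inverse>)"
proof
  show "(x, x) \<in> r\<inverse>" if "x \<in> C" for x using that le_refl by simp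
  show "(x, z) \<in> r\<inverse>" if "(x, y) \<in> r\<inverse>" "(y, z) \<in> r\<inverse>" for x y z
    using that le_trans[of z y x] by simp
  show "x = y" if "(x, y) \<in> r\<inverse>" "(y, x) \<in> r\<inverse>" for x y
    using that le_antisym[of x y] by simp
  show "(x, y) \<in> r\<inverse> \<or> (y, x) \<in> r\<inverse>" if "x \<in> C" "y \<in> C" for x y
    using that le_total[of x y] by auto
qed

lemma autD:
  assumes "f \<in> chain_aut C r"
  shows "x \<in> C \<Longrightarrow> f x \<in> C" and "x \<notin> C \<Longrightarrow> f x = x"
    and "x \<in> C \<Longrightarrow> y \<in> C \<Longrightarrow> (f x, f y) \<in> r \<longleftrightarrow> (x, y) \<in> r"
    and "y \<in> C \<Longrightarrow> \<exists>x\<in>C. f x = y"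
proof -
  have f: "f ` C = C" "\<forall>x. x \<notin> C \<longrightarrow> f x = x" "\<forall>x\<in>C. \<forall>y\<in>C. (f x, f y) \<in> r \<longleftrightarrow> (x, y) \<in> r"
    using assms by (auto simp: chain_aut_def)
  show "x \<in> C \<Longrightarrow> f x \<in> C" using f(1) by blast
  show "x \<notin> C \<Longrightarrow> f x = x" using f(2) by blast
  show "x \<in> C \<Longrightarrow> y \<in> C \<Longrightarrow> (f x, f y) \<in> r \<longleftrightarrow> (x, y) \<in> r" using f(3) by blast
  show "y \<in> C \<Longrightarrow> \<exists>x\<in>C. f x = y" using f(1) by (metis imageE)
qed

text \<open>In a chain an injective order-preserving map also reflects the order, so one implication
  suffices.\<close>

lemma autI:
  assumes "\<And>x. x \<in> C \<Longrightarrow> f x \<in> C" and "\<And>x. x \<notin> C \<Longrightarrow> f x = x"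
    and "\<And>x y. x \<in> C \<Longrightarrow> y \<in> C \<Longrightarrow> (x, y) \<in> r \<Longrightarrow> (f x, f y) \<in> r"
    and "\<And>x y. x \<in> C \<Longrightarrow> y \<in> C \<Longrightarrow> f x = f y \<Longrightarrow> x = y"
    and "\<And>y. y \<in> C \<Longrightarrow> \<exists>x\<in>C. f x = y"
  shows "f \<in> chain_aut C r"
proof -
  have "(x, y) \<in> r" if "x \<in> C" "y \<in> C" "(f x, f y) \<in> r" for x y
    using le_total[OF that(1,2)] le_antisym[OF that(3)] assms(3)[OF that(2,1)] assms(4)[OF that(1,2)]
      le_refl[OF that(1)] by auto
  then have "\<forall>x\<in>C. \<forall>y\<in>C. (f x, f y) \<in> r \<longleftrightarrow> (x, y) \<in> r" using assms(3) by blast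
  moreover have "f ` C = C" using assms(1,5) by (metis image_eqI image_subsetI subsetI subset_antisym)
  ultimately show ?thesis using assms(2) by (simp add: chain_aut_def)
qed

lemma aut_inj:
  assumes "f \<in> chain_aut C r" "x \<in> C" "y \<in> C" "f x = f y"
  shows "x = y"
proof (rule le_antisym)
  show "(x, y) \<in> r" "(y, x) \<in> r"
    using autD(3)[OF assms(1-3)] autD(3)[OF assms(1,3,2)] assms(4)
      le_refl[OF autD(1)[OF assms(1,2)]] by simp_all
qed

lemma aut_comp:
  assumes f: "f \<in> chain_aut C r" and g: "g \<in> chain_aut C r"
  shows "g \<circ> f \<in> chain_aut C r"
proof -
  have "(g \<circ> f) ` C = C" using f g by (simp only: chain_aut_def image_comp[symmetric] mem_Collect_eq)
  then show ?thesis using autD(1-3)[OF f] autD(1-3)[OF g] by (simp add: chain_aut_def)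
qed

text \<open>As products compose from left to right, \<open>f \<circ> g\<close> is the product of
  \<open>g\<close> and \<open>f\<close>, so \<open>g\<close> is the left inverse that
  \<open>groupI\<close> asks for.\<close>

lemma aut_inverse:
  assumes f: "f \<in> chain_aut C r"
  shows "\<exists>g\<in>chain_aut C r. f \<circ> g = id"
proof -
  define g where "g y = (if y \<in> C then SOME x. x \<in> C \<and> f x = y else y)" for y
  have g: "g y \<in> C \<and> f (g y) = y" if "y \<in> C" for y
  proof -
    have "\<exists>x. x \<in> C \<and> f x = y" using autD(4)[OF f that] by blast
    then show ?thesis using that someI_ex[of "\<lambda>x. x \<in> C \<and> f x = y"] by (simp add: g_def)
  qed
  have "g \<in> chain_aut C r"
  proof (rule autI)
    fix x y assume xy: "x \<in> C" "y \<in> C"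
    show "g x \<in> C" using g xy by blast
    show "(g x, g y) \<in> r" if "(x, y) \<in> r"
      using autD(3)[OF f, of "g x" "g y"] g[OF xy(1)] g[OF xy(2)] that by simp
    show "x = y" if "g x = g y" using g[OF xy(1)] g[OF xy(2)] that by metis
    show "\<exists>z\<in>C. g z = x"
    proof
      have fx: "f x \<in> C" using autD(1)[OF f xy(1)] .
      show "g (f x) = x" using g[OF fx] aut_inj[OF f _ xy(1)] by simp
    qed (use autD(1)[OF f xy(1)] in simp)
  qed (simp add: g_def)
  moreover have "f \<circ> g = id"
  proof
    fix y show "(f \<circ> g) y = id y"
      using g[of y] autD(2)[OF f, of y] by (cases "y \<in> C") (auto simp: g_def)
  qed
  ultimately show ?thesis by blast
qed

text \<open>The pointwise minimum is strictly increasing because \<open>f\<close> and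
  \<open>g\<close> are. It takes the value \<open>y\<close> at the larger of the preimages of
  \<open>y\<close> under \<open>f\<close> and \<open>g\<close>.\<close>

lemma aut_meet:
  assumes f: "f \<in> chain_aut C r" and g: "g \<in> chain_aut C r"
  shows "(\<lambda>x. if (f x, g x) \<in> r then f x else g x) \<in> chain_aut C r" (is "?m \<in> _")
proof (rule autI)
  note c = autD(1)[OF f] autD(1)[OF g]
  have lower: "(?m x, f x) \<in> r" "(?m x, g x) \<in> r" if "x \<in> C" for x
    using that c le_refl le_total by (auto, blast)
  fix x y assume xy: "x \<in> C" "y \<in> C"
  show "?m x \<in> C" using c xy by simp
  show mono: "(?m x, ?m y) \<in> r" if "(x, y) \<in> r"
  proof -
    have "(f x, f y) \<in> r" "(g x, g y) \<in> r" using that xy autD(3)[OF f] autD(3)[OF g] by auto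
    then show ?thesis using lower[OF xy(1)] le_trans by (metis (full_types))
  qed
  show "x = y" if "?m x = ?m y"
  proof (rule ccontr)
    assume "x \<noteq> y"
    have *: "?m u \<noteq> ?m v" if uv: "u \<in> C" "v \<in> C" "(u, v) \<in> r" "u \<noteq> v" for u v
    proof
      assume eq: "?m u = ?m v"
      have n: "(f v, f u) \<notin> r" "(g v, g u) \<notin> r"
        using uv autD(3)[OF f] autD(3)[OF g] le_antisym by blast+
      show False using eq lower[OF uv(1)] n by (auto split: if_splits)
    qed
    show False using *[of x y] *[of y x] xy \<open>x \<noteq> y\<close> that le_total[OF xy] by auto
  qed
next
  fix x assume "x \<notin> C"
  then show "?m x = x" using autD(2)[OF f] autD(2)[OF g] by simp
next
  fix y assume y: "y \<in> C"
  obtain u v where u: "u \<in> C" "f u = y" and v: "v \<in> C" "g v = y"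
    using autD(4)[OF f y] autD(4)[OF g y] by blast
  show "\<exists>x\<in>C. ?m x = y"
  proof (cases "(u, v) \<in> r")
    case True
    then have "(f u, f v) \<in> r" using u v autD(3)[OF f] by blast
    then have "?m v = y" using u v le_antisym by auto
    then show ?thesis using v by blast
  next
    case False
    then have "(v, u) \<in> r" using u v le_total by blast
    then have "(g v, g u) \<in> r" using u v autD(3)[OF g] by blast
    then have "?m u = y" using u v le_antisym by auto
    then show ?thesis using u by blast
  qed
qed

lemma aut_join:
  assumes f: "f \<in> chain_aut C r" and g: "g \<in> chain_aut C r"
  shows "(\<lambda>x. if (f x, g x) \<in> r then g x else f x) \<in> chain_aut C r"
proof -
  interpret conv: chain C "r\<inverse>" by (rule chain_converse)
  have eq: "chain_aut C (r\<inverse>) = chain_aut C r" by (auto simp: chain_aut_def)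
  have "(\<lambda>x. if (g x, f x) \<in> r\<inverse> then g x else f x) \<in> chain_aut C (r\<inverse>)"
    using f g by (intro conv.aut_meet) (simp_all add: eq)
  then show ?thesis by (simp add: eq)
qed

lemma le_iff_pointwise:
  assumes "f \<in> chain_aut C r" "g \<in> chain_aut C r"
  shows "lg_le (chain_lgroup C r) f g \<longleftrightarrow> (\<forall>x\<in>C. (f x, g x) \<in> r)"
proof
  assume le: "lg_le (chain_lgroup C r) f g"
  show "\<forall>x\<in>C. (f x, g x) \<in> r"
  proof
    fix x assume x: "x \<in> C"
    have "(if (f x, g x) \<in> r then f x else g x) = f x"
      using fun_cong[OF le[unfolded lg_le_def chain_lgroup_def], of x] by simp
    then show "(f x, g x) \<in> r" using le_refl autD(1)[OF assms(2) x] by (metis (full_types))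
  qed
next
  assume "\<forall>x\<in>C. (f x, g x) \<in> r"
  then have "(if (f x, g x) \<in> r then f x else g x) = f x" for x
    using autD(2)[OF assms(1), of x] autD(2)[OF assms(2), of x] by (cases "x \<in> C") auto
  then show "lg_le (chain_lgroup C r) f g" by (simp add: lg_le_def chain_lgroup_def)
qed

lemma group_chain_lgroup: "group (chain_lgroup C r)"
proof (rule groupI)
  fix f assume "f \<in> carrier (chain_lgroup C r)"
  then show "\<exists>g\<in>carrier (chain_lgroup C r). g \<otimes>\<^bsub>chain_lgroup C r\<^esub> f = \<one>\<^bsub>chain_lgroup C r\<^esub>"
    using aut_inverse by (simp add: chain_lgroup_def)
qed (auto simp: chain_lgroup_def aut_comp comp_assoc, auto simp: chain_aut_def)

lemma l_group_chain_lgroup: "l_group (chain_lgroup C r)"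
proof (intro l_group.intro group_chain_lgroup l_group_axioms.intro)
  let ?L = "chain_lgroup C r"
  have car: "carrier ?L = chain_aut C r" by (simp add: chain_lgroup_def)
  have cases: "x \<in> C \<Longrightarrow> f x \<in> C" "x \<notin> C \<Longrightarrow> f x = x" if "f \<in> chain_aut C r" for f x
    using autD[OF that] by auto
  \<comment> \<open>The last disjunct covers the points outside \<open>C\<close>, which all
    automorphisms fix.\<close>
  have total: "(f x, g x) \<in> r \<or> (g x, f x) \<in> r \<or> f x = g x"
    if "f \<in> carrier ?L" "g \<in> carrier ?L" for f g x
    using that cases le_total unfolding car by metis
  {
    fix f g assume fg: "f \<in> carrier ?L" "g \<in> carrier ?L"
    then show "lmeet ?L f g \<in> carrier ?L" "ljoin ?L f g \<in> carrier ?L"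
      using aut_meet aut_join by (simp_all add: chain_lgroup_def)
    have fgx: "(f x, g x) \<in> r \<or> (g x, f x) \<in> r \<or> f x = g x" for x using total[OF fg] .
    show "lmeet ?L f g = lmeet ?L g f" "ljoin ?L f g = ljoin ?L g f"
      "lmeet ?L f (ljoin ?L f g) = f" "ljoin ?L f (lmeet ?L f g) = f"
    proof (rule_tac [!] ext)
      fix x
      show "lmeet ?L f g x = lmeet ?L g f x" "ljoin ?L f g x = ljoin ?L g f x"
        "lmeet ?L f (ljoin ?L f g) x = f x" "ljoin ?L f (lmeet ?L f g) x = f x"
        using fgx[of x] le_antisym[of "f x" "g x"] by (auto simp: chain_lgroup_def)
    qed
    fix h assume h: "h \<in> carrier ?L"
    show "lmeet ?L (lmeet ?L f g) h = lmeet ?L f (lmeet ?L g h)"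
      "ljoin ?L (ljoin ?L f g) h = ljoin ?L f (ljoin ?L g h)"
    proof (rule_tac [!] ext)
      fix x
      show "lmeet ?L (lmeet ?L f g) h x = lmeet ?L f (lmeet ?L g h) x"
        "ljoin ?L (ljoin ?L f g) h x = ljoin ?L f (ljoin ?L g h) x"
        using fgx[of x] total[OF fg(2) h, of x] le_antisym[of "f x" "h x"]
          le_trans[of "f x" "g x" "h x"] le_trans[of "h x" "g x" "f x"]
        by (auto simp: chain_lgroup_def)
    qed
    fix d assume d: "d \<in> carrier ?L" and le: "lg_le ?L f g"
    \<comment> \<open>\<open>h\<close> acts first and only moves the point of comparison;
      \<open>d\<close> acts last and preserves the order.\<close>
    have "(d (f (h x)), d (g (h x))) \<in> r" if "x \<in> C" for x
    proof -
      have "h x \<in> C" using that h autD(1) car by blast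
      moreover from this have "f (h x) \<in> C" "g (h x) \<in> C" using fg autD(1) car by blast+
      ultimately show ?thesis
        using le fg d autD(3)[of d "f (h x)" "g (h x)"] le_iff_pointwise[of f g] by (simp add: car)
    qed
    then show "lg_le ?L (h \<otimes>\<^bsub>?L\<^esub> f \<otimes>\<^bsub>?L\<^esub> d) (h \<otimes>\<^bsub>?L\<^esub> g \<otimes>\<^bsub>?L\<^esub> d)"
      using fg h d aut_comp le_iff_pointwise[of "d \<circ> (f \<circ> h)" "d \<circ> (g \<circ> h)"]
      by (simp add: chain_lgroup_def)
  }
qed

end

text \<open>At each point \<open>ljoin\<close> selects one of its two arguments.\<close>

lemma lg_Join_chain_lgroup:
  "fs \<noteq> [] \<Longrightarrow> \<exists>f\<in>set fs. lg_Join (chain_lgroup C r) fs x = f x"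
  by (induction fs rule: induct_list012) (auto simp: chain_lgroup_def)

lemma (in group) chain_right_order:
  assumes "right_order G r" shows "chain (carrier G) r"
proof -
  have "partial_right_order G r" using assms by (simp add: right_order_def)
  note D = partial_right_orderD[OF this]
  show ?thesis
  proof qed (fact D(2), fact D(3), fact D(4), fact right_order_total[OF assms])
qed

definition right_translation :: "('a, 'm) monoid_scheme \<Rightarrow> 'a \<Rightarrow> 'a \<Rightarrow> 'a" where
  "right_translation G g x = (if x \<in> carrier G then x \<otimes>\<^bsub>G\<^esub> g else x)"

text \<open>Right invariance of \<open>r\<close> makes right translations monotone, also for the
  reversed order. Since x (g h) = (x g) h applies \<open>g\<close> first, products match.\<close>

lemma (in group) right_translation_hom:
  assumes r: "right_order G r"
  shows "right_translation G \<in> hom G (chain_lgroup (carrier G) (r\<inverse>))"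
proof -
  have "partial_right_order G r" using assms by (simp add: right_order_def)
  note D = partial_right_orderD[OF this]
  interpret chain "carrier G" r using r by (rule chain_right_order)
  interpret conv: chain "carrier G" "r\<inverse>" by (rule chain_converse)
  have "right_translation G g \<in> chain_aut (carrier G) (r\<inverse>)" if g: "g \<in> carrier G" for g
  proof (rule conv.autI)
    fix y assume y: "y \<in> carrier G"
    then have "right_translation G g (y \<otimes> inv g) = y"
      using g by (simp add: right_translation_def m_assoc)
    then show "\<exists>x\<in>carrier G. right_translation G g x = y" using y g by blast
  qed (use g D(5) in \<open>auto simp: right_translation_def\<close>)
  moreover have "right_translation G (g \<otimes> h) = right_translation G h \<circ> right_translation G g"
    if "g \<in> carrier G" "h \<in> carrier G" for g h
    using that by (auto simp: right_translation_def m_assoc fun_eq_iff)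
  ultimately show ?thesis by (auto simp: hom_def chain_lgroup_def)
qed

section \<open>Evaluating group terms through the free group\<close>

lemma geval_hom:
  assumes h: "h \<in> hom G H" and G: "group G" "group H" and \<phi>: "\<phi> \<in> {..<k} \<rightarrow> carrier G"
    and eq: "\<forall>i<k. h (\<phi> i) = \<psi> i" and "gvars t \<subseteq> {..<k}"
  shows "geval G \<phi> t \<in> carrier G \<and> geval H \<psi> t = h (geval G \<phi> t)"
proof -
  interpret group_hom G H h
    using h G by (simp add: group_hom_def group_hom_axioms_def)
  show ?thesis
    using \<open>gvars t \<subseteq> {..<k}\<close> by (induction t) (use \<phi> eq in auto)
qed

lemma free_image_closed:
  "gvars t \<subseteq> {..<k} \<Longrightarrow> free_image k t \<in> carrier (free_group k)"
  \<comment> \<open>With the identity homomorphism only the closure half of \<open>geval_hom\<close>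
    matters.\<close>
  using geval_hom[of id "free_group k" "free_group k" free_gen k free_gen t]
  by (auto simp: free_image_def hom_def group_free_group free_gen_closed)

lemma geval_free_image:
  assumes "h \<in> hom (free_group k) H" "group H" "\<forall>i<k. h (free_gen i) = \<psi> i" "gvars t \<subseteq> {..<k}"
  shows "geval H \<psi> t = h (free_image k t)"
  using geval_hom[OF assms(1) group_free_group assms(2) _ assms(3,4)]
  by (auto simp: free_image_def free_gen_closed)

section \<open>From right orders to failing inequations and back\<close>

lemma right_order_refutes_LG_models:
  assumes ne: "ts \<noteq> []" and vars: "\<forall>t \<in> set ts. gvars t \<subseteq> {..<k}"
    and "extends_to_right_order (free_group k) (free_image k ` set ts)"
  shows "\<not> LG_models TYPE('a::infinite) k ts"
proof
  let ?F = "free_group k"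
  interpret F: group ?F by (rule group_free_group)
  obtain r where r: "right_order ?F r" and pos: "\<forall>s\<in>free_image k ` set ts. strict r \<one>\<^bsub>?F\<^esub> s"
    using assms(3) by (auto simp: extends_to_right_order_def)
  interpret chain "carrier ?F" r using r by (rule F.chain_right_order)
  interpret conv: chain "carrier ?F" "r\<inverse>" by (rule chain_converse)
  let ?L = "chain_lgroup (carrier ?F) (r\<inverse>)" and ?\<rho> = "right_translation ?F"
  let ?\<phi> = "?\<rho> \<circ> free_gen"
  interpret L: l_group ?L by (rule conv.l_group_chain_lgroup)
  have hom: "?\<rho> \<in> hom ?F ?L" using r by (rule F.right_translation_hom)
  assume "LG_models TYPE('a) k ts"
  \<comment> \<open>The automorphisms are functions on words, so validity is first carried to their
    type.\<close>
  then have "LG_models TYPE(letter list \<Rightarrow> letter list) k ts"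
    using ne vars by (rule LG_models_any_type)
  moreover have "?\<phi> \<in> {..<k} \<rightarrow> carrier ?L"
    using hom free_gen_closed by (auto simp: hom_def)
  ultimately have "lg_le ?L \<one>\<^bsub>?L\<^esub> (lg_Join ?L (map (geval ?L ?\<phi>) ts))"
    using L.l_group_axioms by (simp add: LG_models_def)
  moreover have ev: "geval ?L ?\<phi> t = ?\<rho> (free_image k t)" if "t \<in> set ts" for t
    using geval_free_image[OF hom L.group_axioms] vars that by simp
  moreover have "?\<rho> (free_image k t) \<in> carrier ?L" if "t \<in> set ts" for t
    using hom free_image_closed vars that by (auto simp: hom_def)
  ultimately have le: "lg_le ?L \<one>\<^bsub>?L\<^esub> (lg_Join ?L (map (geval ?L ?\<phi>) ts))"
    and J: "lg_Join ?L (map (geval ?L ?\<phi>) ts) \<in> carrier ?L"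
    using L.lg_Join_upper[of "map (geval ?L ?\<phi>) ts" "geval ?L ?\<phi> (hd ts)"] ne by auto
  \<comment> \<open>At the identity the join agrees with the translation by one of the
    \<open>t\<close>, whose value there is \<open>free_image k t\<close>. In the reversed order, one
    <= join then places this word at or below the identity in \<open>r\<close>, against its
    positivity.\<close>
  obtain t where t: "t \<in> set ts"
    and "lg_Join ?L (map (geval ?L ?\<phi>) ts) \<one>\<^bsub>?F\<^esub> = ?\<rho> (free_image k t) \<one>\<^bsub>?F\<^esub>"
    using lg_Join_chain_lgroup[of "map (geval ?L ?\<phi>) ts" "carrier ?F" "r\<inverse>" "\<one>\<^bsub>?F\<^esub>"] ne ev
    by auto
  moreover have "\<forall>x\<in>carrier ?F. (x, lg_Join ?L (map (geval ?L ?\<phi>) ts) x) \<in> r\<inverse>"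
    using le J conv.le_iff_pointwise[of id] L.one_closed by (simp add: chain_lgroup_def)
  ultimately have "(?\<rho> (free_image k t) \<one>\<^bsub>?F\<^esub>, \<one>\<^bsub>?F\<^esub>) \<in> r" by force
  then have "(free_image k t, \<one>\<^bsub>?F\<^esub>) \<in> r"
    using free_image_closed vars t by (simp add: right_translation_def)
  then show False using pos t le_antisym by (force simp: strict_def)
qed

lemma refuted_LG_models_right_order:
  assumes vars: "\<forall>t \<in> set ts. gvars t \<subseteq> {..<k}" and "ts \<noteq> []"
    and "\<not> LG_models TYPE('a) k ts"
  shows "extends_to_right_order (free_group k) (free_image k ` set ts)"
proof -
  let ?F = "free_group k"
  interpret F: group ?F by (rule group_free_group)
  obtain L :: "'a lgroup" and \<phi> where L: "l_group L" and \<phi>: "\<phi> \<in> {..<k} \<rightarrow> carrier L"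
    and nle: "\<not> lg_le L \<one>\<^bsub>L\<^esub> (lg_Join L (map (geval L \<phi>) ts))"
    using assms(3) by (auto simp: LG_models_def)
  interpret L: l_group L by fact
  obtain h where h: "h \<in> hom ?F L" "\<forall>i<k. h (free_gen i) = \<phi> i"
    using free_group_universal[OF L.group_axioms \<phi>] by blast
  interpret h: group_hom ?F L h
    using h by (simp add: group_hom_def group_hom_axioms_def L.group_axioms F.group_axioms)
  define w where "w = lg_Join L (map (geval L \<phi>) ts)"
  have ev: "geval L \<phi> t = h (free_image k t)" "free_image k t \<in> carrier ?F" if "t \<in> set ts" for t
    using geval_free_image[OF h(1) L.group_axioms h(2)] free_image_closed vars that by auto
  have w: "w \<in> carrier L" "lg_le L (h (free_image k t)) w" if "t \<in> set ts" for t
  proof -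
    have "set (map (geval L \<phi>) ts) \<subseteq> carrier L" using ev by (auto intro: h.hom_closed)
    then show "w \<in> carrier L" "lg_le L (h (free_image k t)) w"
      using L.lg_Join_upper[of "map (geval L \<phi>) ts" "geval L \<phi> t"] ev(1)[OF that] that
      unfolding w_def set_map by (metis image_eqI)+
  qed
  have wL: "w \<in> carrier L" using w(1) \<open>ts \<noteq> []\<close> by (cases ts) auto
  \<comment> \<open>Every \<open>free_image k t\<close> belongs to this set of words, so avoiding it
    means omitting them all.\<close>
  let ?B = "{x. lg_le L (h x) w}"
  have "signable ?F (carrier ?F) ?B {}"
    unfolding signable_def
  proof (intro allI impI)
    fix A assume A: "finite A \<and> A \<subseteq> carrier ?F"
    then have "finite (h ` A)" "h ` A \<subseteq> carrier L" by auto
    from L.sign_choice[OF this wL nle[folded w_def]]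
    obtain E where E: "E \<subseteq> carrier L" "\<forall>a\<in>h ` A. a \<in> E \<or> inv\<^bsub>L\<^esub> a \<in> E"
      "\<forall>x\<in>subsemigroup L E. \<not> lg_le L x w"
      by blast
    \<comment> \<open>The preimage under \<open>h\<close> inherits a sign for each element of
      \<open>A\<close>, and \<open>h\<close> carries its products to products of \<open>E\<close>,
      which are not below \<open>w\<close>.\<close>
    let ?E = "{x \<in> carrier ?F. h x \<in> E}"
    have "\<forall>a\<in>A. a \<in> ?E \<or> inv\<^bsub>?F\<^esub> a \<in> ?E"
    proof
      fix a assume "a \<in> A"
      then have "a \<in> carrier ?F" "h a \<in> E \<or> inv\<^bsub>L\<^esub> h a \<in> E" using A E(2) by auto
      then show "a \<in> ?E \<or> inv\<^bsub>?F\<^esub> a \<in> ?E" by auto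
    qed
    moreover have "subsemigroup ?F ?E \<inter> ?B = {}"
      using subsemigroup_hom[OF h(1) _ F.group_axioms, of ?E E] E(3) by auto
    ultimately show "\<exists>E\<subseteq>carrier ?F. (\<forall>a\<in>A. a \<in> E \<or> inv\<^bsub>?F\<^esub> a \<in> E) \<and>
        subsemigroup ?F ({} \<union> E) \<inter> ?B = {}"
      by (intro exI[of _ ?E]) auto
  qed
  then obtain S where S: "S \<subseteq> carrier ?F" "\<forall>a\<in>carrier ?F. a \<in> S \<or> inv\<^bsub>?F\<^esub> a \<in> S"
    "subsemigroup ?F S \<inter> ?B = {}"
    using signable_total_extension[OF F.group_axioms, of "carrier ?F" ?B "{}"] by auto
  let ?M = "subsemigroup ?F S"
  \<comment> \<open>\<open>?M\<close> is total by the choice of \<open>S\<close>. It misses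
    \<open>?B\<close>, so the words of \<open>ts\<close> enter the cone as elements of its
    complement.\<close>
  have "positive_cone ?F {x \<in> carrier ?F. x \<notin> ?M \<or>
      inv\<^bsub>?F\<^esub> x \<in> ?M \<and> x \<in> {w \<in> carrier ?F. path_weight w > 0}}"
    using S F.subsemigroup_closed[OF S(1)]
    by (intro F.positive_cone_refine positive_cone_free_group) (auto intro: subsemigroup.intros)
  moreover have "free_image k t \<notin> ?M" if "t \<in> set ts" for t
    using w(2)[OF that] S(3) by auto
  ultimately show ?thesis
    using ev by (intro F.positive_cone_extends_to_right_order) auto
qed

theorem theorem4:
  fixes k :: nat and ts :: "gterm list"
  assumes "ts \<noteq> []" and "\<forall>t \<in> set ts. gvars t \<subseteq> {..<k}"
  shows
    "(LG_models TYPE('a::infinite) k ts \<longleftrightarrow>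
        \<not> extends_to_right_order (free_group k) (free_image k ` set ts))
     \<and>
     (\<not> extends_to_right_order (free_group k) (free_image k ` set ts) \<longleftrightarrow>
        (\<exists>(m::nat) s. (\<forall>i<m. s i \<in> carrier (free_group k) - {\<one>\<^bsub>free_group k\<^esub>}) \<and>
           (\<forall>\<delta> :: nat \<Rightarrow> int. (\<forall>i<m. \<delta> i \<in> {-1, 1}) \<longrightarrow>
              \<one>\<^bsub>free_group k\<^esub> \<in> subsemigroup (free_group k)
                (free_image k ` set ts \<union> {s i [^]\<^bsub>free_group k\<^esub> \<delta> i | i. i < m}))))"
proof
  show "LG_models TYPE('a) k ts \<longleftrightarrow>
      \<not> extends_to_right_order (free_group k) (free_image k ` set ts)"
    using right_order_refutes_LG_models[OF assms] refuted_LG_models_right_order[OF assms(2,1)]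
    by blast
  have "free_image k ` set ts \<subseteq> carrier (free_group k)"
    using assms(2) free_image_closed by blast
  from extends_to_right_order_iff_signs[OF group_free_group this]
  show "\<not> extends_to_right_order (free_group k) (free_image k ` set ts) \<longleftrightarrow>
        (\<exists>(m::nat) s. (\<forall>i<m. s i \<in> carrier (free_group k) - {\<one>\<^bsub>free_group k\<^esub>}) \<and>
           (\<forall>\<delta> :: nat \<Rightarrow> int. (\<forall>i<m. \<delta> i \<in> {-1, 1}) \<longrightarrow>
              \<one>\<^bsub>free_group k\<^esub> \<in> subsemigroup (free_group k)
                (free_image k ` set ts \<union> {s i [^]\<^bsub>free_group k\<^esub> \<delta> i | i. i < m})))"
    by argo
qed

end
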